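(* For every $s$ with $1/2<s<1$ there exists an (explicit) universal constant $\mathcal{C}_s>0$, depending only on $s$, such that for every open simply connected set $\Omega\subset\mathbb{R}^2$ with finite inradius $r_\Omega$, \[ \lambda_1^s(\Omega)\ge \frac{\mathcal{C}_s}{r_\Omega^{2s}}. \] Moreover, $\mathcal{C}_s$ has the following asymptotic behaviours: \[ \mathcal{C}_s\sim \left(s-\frac12\right)\ \text{ for } s\searrow \frac12,\qquad\text{and}\qquad \mathcal{C}_s\sim\frac{1}{1-s}\ \text{ for } s\nearrow 1. \]
   Context: For an open set $\Omega\subset\mathbb{R}^N$, $C^\infty_0(\Omega)$ is the space of smooth functions with compact support in $\Omega$ (extended by zero to $\mathbb{R}^N$). For $0<s<1$, \[ [u]_{W^{s,2}(\mathbb{R}^N)}=\left(\iint_{\mathbb{R}^N\times\mathbb{R}^N}\frac{|u(x)-u(y)|^2}{|x-y|^{N+2s}}\,dx\,dy\right)^{1/2}, \] $W^{s,2}(\mathbb{R}^N)=\{u\in L^2(\mathbb{R}^N): [u]_{W^{s,2}(\mathbb{R}^N)}<+\infty\}$ with norm $\|u\|_{L^2(\mathbb{R}^N)}+[u]_{W^{s,2}(\mathbb{R}^N)}$, and $\widetilde W^{s,2}_0(\Omega)$ is the closure of $C^\infty_0(\Omega)$ in $W^{s,2}(\mathbb{R}^N)$. Set \[ \lambda_1^s(\Omega)=\inf_{u\in\widetilde W^{s,2}_0(\Omega)\setminus\{0\}}\frac{[u]^2_{W^{s,2}(\mathbb{R}^N)}}{\|u\|^2_{L^2(\Omega)}}.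 \] The inradius is $r_\Omega=\sup\{\rho>0:\exists\,x\in\Omega \text{ such that } B_\rho(x)\subset\Omega\}$, where $B_\rho(x)$ is the open ball of radius $\rho$ and center $x$. Simply connected means nonempty, connected, and with every closed loop null-homotopic. The notation $f(s)\sim g(s)$ as $s\to a$ means that $f(s)/g(s)$ tends to a finite, strictly positive limit as $s\to a$. *)

theory Defs
  imports "HOL-Analysis.Analysis"
begin

text \<open>
  \<open>C_k k f\<close> says that \<open>f\<close> is \<open>k\<close> times continuously differentiable on the whole space: \<open>f\<close> is
  differentiable and all its directional derivatives are \<open>k - 1\<close> times continuously
  differentiable.
\<close>

primrec C_k :: "nat \<Rightarrow> ('a::euclidean_space \<Rightarrow> real) \<Rightarrow> bool" where
  "C_k 0 f \<longleftrightarrow> continuous_on UNIV f"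
| "C_k (Suc k) f \<longleftrightarrow>
     f differentiable_on UNIV \<and> (\<forall>v. C_k k (\<lambda>x. frechet_derivative f (at x) v))"

definition test_functions :: "'a::euclidean_space set \<Rightarrow> ('a \<Rightarrow> real) set" where
  "test_functions \<Omega> =
     {u. (\<forall>k. C_k k u) \<and> compact (closure {x. u x \<noteq> 0}) \<and> closure {x. u x \<noteq> 0} \<subseteq> \<Omega>}"

definition L2_sq :: "'a::euclidean_space set \<Rightarrow> ('a \<Rightarrow> real) \<Rightarrow> ennreal" where
  "L2_sq A u = (\<integral>\<^sup>+x\<in>A. ennreal (\<bar>u x\<bar>\<^sup>2) \<partial>lebesgue)"

text \<open>On the null set \<open>x = y\<close> the quotient is \<open>0 / 0 = 0\<close>.\<close>

definition gagliardo_sq :: "real \<Rightarrow> ('a::euclidean_space \<Rightarrow> real) \<Rightarrow> ennreal" where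
  "gagliardo_sq s u =
     (\<integral>\<^sup>+(x, y). ennreal (\<bar>u x - u y\<bar>\<^sup>2 / norm (x - y) powr (real DIM('a) + 2 * s))
        \<partial>(lebesgue \<Otimes>\<^sub>M lebesgue))"

text \<open>
  Elements of \<open>L\<^sup>2\<close> and \<open>W\<^sup>s\<^sup>,\<^sup>2\<close> are represented by Lebesgue measurable functions, not by classes
  modulo a.e. equality. The two real-valued quantities below are the norm and seminorm only where
  the underlying integrals are finite (\<open>enn2real \<infinity> = 0\<close>).
\<close>

definition L2_norm :: "'a::euclidean_space set \<Rightarrow> ('a \<Rightarrow> real) \<Rightarrow> real" where
  "L2_norm A u = sqrt (enn2real (L2_sq A u))"

definition gagliardo_seminorm :: "real \<Rightarrow> ('a::euclidean_space \<Rightarrow> real) \<Rightarrow> real" where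
  "gagliardo_seminorm s u = sqrt (enn2real (gagliardo_sq s u))"

definition sobolev :: "real \<Rightarrow> ('a::euclidean_space \<Rightarrow> real) set" where
  "sobolev s = {u \<in> borel_measurable lebesgue. L2_sq UNIV u < \<infinity> \<and> gagliardo_sq s u < \<infinity>}"

definition sobolev_norm :: "real \<Rightarrow> ('a::euclidean_space \<Rightarrow> real) \<Rightarrow> real" where
  "sobolev_norm s u = L2_norm UNIV u + gagliardo_seminorm s u"

text \<open>
  The closure of the test functions in \<open>W\<^sup>s\<^sup>,\<^sup>2\<close>. For \<open>0 < s < 1\<close> every test function lies in
  \<open>sobolev s\<close>, so \<open>sobolev_norm\<close> is only applied to elements of \<open>sobolev s\<close>.
\<close>

definition sobolev0 :: "real \<Rightarrow> 'a::euclidean_space set \<Rightarrow> ('a \<Rightarrow> real) set" where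
  "sobolev0 s \<Omega> =
     {u \<in> sobolev s. \<forall>\<epsilon>>0. \<exists>\<phi>\<in>test_functions \<Omega>. sobolev_norm s (\<lambda>x. u x - \<phi> x) < \<epsilon>}"

text \<open>
  Being nonzero in \<open>W\<^sup>s\<^sup>,\<^sup>2\<close> means not vanishing almost everywhere. The infimum is taken in
  the extended reals, so that it is \<open>\<infinity>\<close> rather than unspecified over the empty set
  (i.e. for empty \<open>\<Omega>\<close>).
\<close>

definition first_eigenvalue :: "real \<Rightarrow> 'a::euclidean_space set \<Rightarrow> ereal" where
  "first_eigenvalue s \<Omega> =
     (INF u \<in> {u \<in> sobolev0 s \<Omega>. \<not> (AE x in lebesgue. u x = 0)}.
        ereal ((gagliardo_seminorm s u)\<^sup>2 / (L2_norm \<Omega> u)\<^sup>2))"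

definition inradius :: "'a::euclidean_space set \<Rightarrow> ereal" where
  "inradius \<Omega> = (SUP \<rho> \<in> {\<rho>. 0 < \<rho> \<and> (\<exists>x\<in>\<Omega>. ball x \<rho> \<subseteq> \<Omega>)}. ereal \<rho>)"

text \<open>The relation \<open>f \<sim> g\<close> up to a positive constant; the limit of \<open>f / g\<close> need not be 1.\<close>

definition comparable_at :: "real filter \<Rightarrow> (real \<Rightarrow> real) \<Rightarrow> (real \<Rightarrow> real) \<Rightarrow> bool" where
  "comparable_at F f g \<longleftrightarrow> (\<exists>L>0. ((\<lambda>s. f s / g s) \<longlongrightarrow> L) F)"

end

theory Submission
  imports Defs "HOL-Complex_Analysis.Complex_Analysis"
begin

text \<open>
  Two facts about the plane carry the proof. In a simply connected open set every component of the
  complement is unbounded, so a component that contains a point \<open>y\<close> meets every square contour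
  \<open>max (\<bar>z\<^sub>1 - y\<^sub>1\<bar>, \<bar>z\<^sub>2 - y\<^sub>2\<bar>) = \<rho>\<close> round \<open>y\<close>
  (\<open>complement_component_plane_map\<close>, \<open>unbounded_connected_meets_squares\<close>). Moreover every ball of
  radius larger than the inradius \<open>r\<close> contains such a point \<open>y\<close>. Scale the plane by \<open>L = 8 r\<close>: then
  every unit cell of the integer grid contains zeros of a test function \<open>u\<close> whose projections to the
  two axes are not both small, so that the cell contains a set of measure at least \<open>1 / 20\<close> each of
  whose points shares a coordinate with a zero in the cell (\<open>zeros_in_unit_cell\<close>).

  Points are connected to zeros along dyadic cells. In each cell choose a point at which the mean
  square difference to the rest of the cell is at most its average. Along the nested cells that
  shrink to a zero \<open>z\<close> the values at the chosen points tend to \<open>u z = 0\<close>, and the consecutive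
  differences are controlled by the double integrals of \<open>(u a - u b)\<^sup>2\<close> over these cells
  (\<open>good_point_near_zero\<close>). Thus the value of \<open>u\<close> at the chosen point of a unit cell is bounded by
  a sum over the cells that contain \<open>z\<close>. Enlarging each of these cells to the whole row and column
  of cells makes the bound depend on only one coordinate of \<open>z\<close>, hence it can be attached to every
  point that shares a coordinate with a zero. Integrating costs the factor \<open>2 / 2 ^ k\<close>, the area of a cross
  of width \<open>1 / 2 ^ k\<close>. This loss of half a derivative is the trace on a line, and it is where
  \<open>s > 1/2\<close> and the factor \<open>s - 1/2\<close> come from. Adding up all unit cells bounds the \<open>L\<^sup>2\<close> norm of
  \<open>u\<close> by a series in \<open>B\<^sub>k\<close>, the integral of \<open>(u (x + h) - u x)\<^sup>2\<close> over all \<open>x\<close> and all \<open>h\<close> with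
  \<open>\<bar>h\<bar> \<le> 2 / 2 ^ k\<close> (\<open>poincare_cell_energies\<close>).

  The factor \<open>1 - s\<close> comes from comparing scales. As \<open>u (x + 2 h) - u x\<close> is a sum of two increments
  by \<open>h\<close>, one has \<open>B\<^sub>k \<le> 16 B\<^sub>k\<^sub>+\<^sub>1\<close>, that is, \<open>a\<^sub>k = 16 ^ k B\<^sub>k\<close> is increasing. Summation by parts
  then gives \<open>(1 - p) \<Sum> p ^ k a\<^sub>k \<le> (1 - q) \<Sum> q ^ k a\<^sub>k\<close> for \<open>p \<le> q\<close> (\<open>abel_weighted_sum_le\<close>). With
  \<open>q = 4 powr (s - 1)\<close> the right-hand series is bounded by the Gagliardo energy of order \<open>s\<close>
  (\<open>suminf_ball_energy_le\<close>) and \<open>1 - q\<close> is at most \<open>2 (1 - s)\<close>; the left-hand series, with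
  \<open>p = 2 powr (s - 3/2)\<close>, is the one obtained from the chains.
  Together this is the inequality with the constant \<open>(s - 1/2) / (1 - s)\<close> up to a universal factor
  (\<open>fractional_poincare_unit_scale\<close>). It passes to the closure of the test functions because
  these have finite norm and seminorm.
\<close>

section \<open>Dyadic cells\<close>

definition dyadic_cell :: "nat \<Rightarrow> real \<times> real \<Rightarrow> (real \<times> real) set" where
  "dyadic_cell k a = {b. \<lfloor>2 ^ k * fst b\<rfloor> = \<lfloor>2 ^ k * fst a\<rfloor> \<and> \<lfloor>2 ^ k * snd b\<rfloor> = \<lfloor>2 ^ k * snd a\<rfloor>}"

text \<open>
  The inner integral of the double energy of a cell: integrating \<open>cell_energy U k\<close> over any union of
  cells of level \<open>k\<close> adds up their double energies, which replaces sums over cells by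
  integrals over points.
\<close>

definition cell_energy :: "(real \<times> real \<Rightarrow> real) \<Rightarrow> nat \<Rightarrow> real \<times> real \<Rightarrow> ennreal" where
  "cell_energy U k a = (\<integral>\<^sup>+b. ennreal ((U a - U b)\<^sup>2) * indicator (dyadic_cell k a) b \<partial>lborel)"

lemma dyadic_cell_self [simp]: "a \<in> dyadic_cell k a"
  by (simp add: dyadic_cell_def)

lemma dyadic_cell_eq: "b \<in> dyadic_cell k a \<Longrightarrow> dyadic_cell k b = dyadic_cell k a"
  by (auto simp: dyadic_cell_def)

lemma dyadic_cell_sym: "b \<in> dyadic_cell k a \<longleftrightarrow> a \<in> dyadic_cell k b"
  by (auto simp: dyadic_cell_def)

lemma floor_double_eq_imp:
  fixes x y :: real
  assumes "\<lfloor>2 * x\<rfloor> = \<lfloor>2 * y\<rfloor>"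
  shows "\<lfloor>x\<rfloor> = \<lfloor>y\<rfloor>"
proof -
  have "2 * \<lfloor>t\<rfloor> \<le> \<lfloor>2 * t\<rfloor>" "\<lfloor>2 * t\<rfloor> \<le> 2 * \<lfloor>t\<rfloor> + 1" for t :: real
    by linarith+
  from this[of x] this[of y] assms show ?thesis by linarith
qed

lemma dyadic_cell_Suc_subset: "dyadic_cell (Suc k) a \<subseteq> dyadic_cell k a"
proof
  fix b assume "b \<in> dyadic_cell (Suc k) a"
  then have "\<lfloor>2 * (2 ^ k * fst b)\<rfloor> = \<lfloor>2 * (2 ^ k * fst a)\<rfloor>"
    "\<lfloor>2 * (2 ^ k * snd b)\<rfloor> = \<lfloor>2 * (2 ^ k * snd a)\<rfloor>"
    unfolding dyadic_cell_def mem_Collect_eq power_Suc mult.assoc by blast+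
  then show "b \<in> dyadic_cell k a"
    unfolding dyadic_cell_def mem_Collect_eq using floor_double_eq_imp by blast
qed

lemma dyadic_cell_subset_0: "dyadic_cell k a \<subseteq> dyadic_cell 0 a"
  by (induction k) (use dyadic_cell_Suc_subset in blast)+

lemma floor_scaled_fibre:
  "{t::real. \<lfloor>2 ^ k * t\<rfloor> = m} = {of_int m / 2 ^ k ..< (of_int m + 1) / 2 ^ k}"
  by (auto simp: floor_eq_iff field_simps)

lemma emeasure_floor_scaled_fibre:
  "emeasure lborel {t::real. \<lfloor>2 ^ k * t\<rfloor> = m} = ennreal (1 / 2 ^ k)"
  unfolding floor_scaled_fibre by (simp add: field_simps)

lemma dyadic_cell_Times:
  "dyadic_cell k a = {t. \<lfloor>2 ^ k * t\<rfloor> = \<lfloor>2 ^ k * fst a\<rfloor>} \<times> {t. \<lfloor>2 ^ k * t\<rfloor> = \<lfloor>2 ^ k * snd a\<rfloor>}"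
  by (auto simp: dyadic_cell_def)

lemma emeasure_lborel_Times:
  assumes "A \<in> sets borel" "B \<in> sets borel"
  shows "emeasure lborel (A \<times> B :: (real \<times> real) set) = emeasure lborel A * emeasure lborel B"
  using assms by (simp add: lborel_prod[symmetric] lborel.emeasure_pair_measure_Times)

lemma emeasure_dyadic_cell: "emeasure lborel (dyadic_cell k a) = ennreal (1 / 4 ^ k)"
proof -
  have "emeasure lborel (dyadic_cell k a) = ennreal (1 / 2 ^ k) * ennreal (1 / 2 ^ k)"
    unfolding dyadic_cell_Times
    by (subst emeasure_lborel_Times) (auto simp: emeasure_floor_scaled_fibre)
  also have "\<dots> = ennreal (1 / 4 ^ k)"
    by (simp add: ennreal_mult[symmetric] power_mult_distrib[symmetric])
  finally show ?thesis .
qed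

lemma measurable_dyadic_cell [measurable]: "dyadic_cell k a \<in> sets borel"
proof -
  have "dyadic_cell k a \<in> sets (borel \<Otimes>\<^sub>M borel)"
    unfolding dyadic_cell_Times by (intro pair_measureI) measurable
  then show ?thesis unfolding borel_prod .
qed

lemma borel_measurable_components:
  fixes h :: "'a \<Rightarrow> real \<times> real"
  assumes "h \<in> borel_measurable M"
  shows "(\<lambda>x. fst (h x)) \<in> borel_measurable M" "(\<lambda>x. snd (h x)) \<in> borel_measurable M"
  using measurable_compose[OF assms borel_measurable_continuous_onI[OF continuous_on_fst[OF continuous_on_id]]]
    measurable_compose[OF assms borel_measurable_continuous_onI[OF continuous_on_snd[OF continuous_on_id]]]
  by auto

lemma measurable_indicator_dyadic_cell [measurable]:
  assumes [measurable]: "f \<in> borel_measurable M" "g \<in> borel_measurable M"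
  shows "(\<lambda>x. indicator (dyadic_cell k (f x)) (g x) :: ennreal) \<in> borel_measurable M"
proof -
  note [measurable] = borel_measurable_components[OF assms(1)] borel_measurable_components[OF assms(2)]
  have "Measurable.pred M (\<lambda>x. g x \<in> dyadic_cell k (f x))"
    unfolding dyadic_cell_def mem_Collect_eq by measurable
  then show ?thesis
    by (simp add: indicator_def)
qed

lemma measurable_cell_energy [measurable]:
  assumes [measurable]: "U \<in> borel_measurable borel"
  shows "cell_energy U k \<in> borel_measurable borel"
  unfolding cell_energy_def by measurable

lemma dist_dyadic_cell:
  assumes "b \<in> dyadic_cell k a"
  shows "norm (b - a) \<le> 2 / 2 ^ k"
proof -
  have *: "\<bar>x - y\<bar> \<le> 1 / 2 ^ k" if "\<lfloor>2 ^ k * x\<rfloor> = \<lfloor>2 ^ k * y\<rfloor>" for x y :: real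
  proof -
    have "\<bar>2 ^ k * x - 2 ^ k * y\<bar> \<le> 1" using that by linarith
    then have "2 ^ k * \<bar>x - y\<bar> \<le> 1"
      by (metis abs_mult abs_of_pos right_diff_distrib zero_less_numeral zero_less_power)
    then show ?thesis by (simp add: field_simps)
  qed
  have "norm (b - a) \<le> \<bar>fst b - fst a\<bar> + \<bar>snd b - snd a\<bar>"
    using norm_Pair_le[of "fst b - fst a" "snd b - snd a"] by (simp add: minus_prod_def)
  also have "\<dots> \<le> 2 / 2 ^ k"
    using assms *[of "fst b" "fst a"] *[of "snd b" "snd a"] by (auto simp: dyadic_cell_def)
  finally show ?thesis .
qed

section \<open>Chains of cells that shrink to a zero\<close>

lemma exists_le_average:
  fixes f :: "'a \<Rightarrow> ennreal"
  assumes [measurable]: "f \<in> borel_measurable M" "D \<in> sets M"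
    and D: "0 < emeasure M D" "emeasure M D < \<infinity>"
  shows "\<exists>a\<in>D. f a * emeasure M D \<le> (\<integral>\<^sup>+x. f x * indicator D x \<partial>M)"
proof (rule ccontr)
  let ?E = "\<integral>\<^sup>+x. f x * indicator D x \<partial>M"
  assume "\<not> ?thesis"
  then have gt: "?E < f a * emeasure M D" if "a \<in> D" for a
    using that by (meson not_le)
  have "D \<noteq> {}" using D by auto
  then have fin: "?E \<noteq> \<infinity>" using gt by fastforce
  define c where "c = ?E / emeasure M D"
  have ccD: "c * emeasure M D = ?E"
    using D unfolding c_def by (simp add: ennreal_divide_times ennreal_mult_divide_eq)
  have c: "c < f a" if "a \<in> D" for a
    using gt[OF that] ccD by (metis ennreal_mult_strict_right_mono linorder_not_less mult_right_mono zero_le)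
  have "(\<integral>\<^sup>+x. c * indicator D x \<partial>M) < (\<integral>\<^sup>+x. f x * indicator D x \<partial>M)"
  proof (rule nn_integral_less)
    show "(\<integral>\<^sup>+x. c * indicator D x \<partial>M) \<noteq> \<infinity>"
      using ccD fin by (simp add: nn_integral_cmult_indicator)
    show "AE x in M. c * indicator D x \<le> f x * indicator D x"
      using c by (auto simp: indicator_def less_imp_le)
    show "\<not> (AE x in M. f x * indicator D x \<le> c * indicator D x)"
    proof
      assume "AE x in M. f x * indicator D x \<le> c * indicator D x"
      then have "AE x in M. x \<notin> D"
      proof eventually_elim
        case (elim x)
        then show "x \<notin> D" using c[of x] by (cases "x \<in> D") auto
      qed
      then have "emeasure M D = 0"
        by (subst (asm) AE_iff_measurable[of D]) (use sets.sets_into_space[of D M] in \<open>auto\<close>)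
      then show False using D by simp
    qed
  qed auto
  then show False using ccD by (simp add: nn_integral_cmult_indicator)
qed

definition cell_double_energy :: "(real \<times> real \<Rightarrow> real) \<Rightarrow> nat \<Rightarrow> real \<times> real \<Rightarrow> ennreal" where
  "cell_double_energy U k z = (\<integral>\<^sup>+a. cell_energy U k a * indicator (dyadic_cell k z) a \<partial>lborel)"

lemma ennreal_power_mult_inverse: "(4::ennreal) ^ k * ennreal (1 / 4 ^ k) = 1"
proof -
  have "(4::ennreal) ^ k = ennreal (4 ^ k)"
    by (simp add: ennreal_power[symmetric])
  then show ?thesis
    by (simp add: ennreal_mult[symmetric] del: ennreal_power)
qed

lemma indicator_dyadic_cell_Suc_le:
  "indicator (dyadic_cell (Suc k) a) b \<le> (indicator (dyadic_cell k a) b :: ennreal)"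
  using dyadic_cell_Suc_subset[of k a] by (auto simp: indicator_def simp del: split_paired_All)

lemma cell_energy_Suc_le: "cell_energy U (Suc k) a \<le> cell_energy U k a"
  unfolding cell_energy_def
  by (intro nn_integral_mono mult_left_mono indicator_dyadic_cell_Suc_le) simp

lemma cell_double_energy_Suc_le: "cell_double_energy U (Suc k) z \<le> cell_double_energy U k z"
  unfolding cell_double_energy_def
  by (intro nn_integral_mono mult_mono cell_energy_Suc_le indicator_dyadic_cell_Suc_le) simp_all

lemma exists_good_point:
  assumes [measurable]: "U \<in> borel_measurable borel"
  shows "\<exists>p\<in>dyadic_cell k z. cell_energy U k p \<le> 4 ^ k * cell_double_energy U k z"
proof -
  obtain p where p: "p \<in> dyadic_cell k z"
    and le: "cell_energy U k p * ennreal (1 / 4 ^ k) \<le> cell_double_energy U k z"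
    using exists_le_average[of "cell_energy U k" lborel "dyadic_cell k z"]
    by (auto simp: emeasure_dyadic_cell cell_double_energy_def)
  have "cell_energy U k p = 4 ^ k * (cell_energy U k p * ennreal (1 / 4 ^ k))"
    using ennreal_power_mult_inverse[of k] by (simp add: ac_simps)
  also have "\<dots> \<le> 4 ^ k * cell_double_energy U k z"
    by (intro mult_left_mono le) simp
  finally show ?thesis using p by blast
qed

text \<open>
  Compare both values with \<open>U b\<close> and average over \<open>b\<close> in the smaller cell. The chosen points make
  both averages at most the mean energy of their cells. The factor is
  \<open>4 ^ Suc k * (2 * 4 ^ Suc k + 2 * 4 ^ k) = 40 * 16 ^ k\<close>.
\<close>

lemma good_point_jump:
  assumes [measurable]: "U \<in> borel_measurable borel"
    and p: "p \<in> dyadic_cell k z" "cell_energy U k p \<le> 4 ^ k * cell_double_energy U k z"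
    and p': "p' \<in> dyadic_cell (Suc k) z"
      "cell_energy U (Suc k) p' \<le> 4 ^ Suc k * cell_double_energy U (Suc k) z"
  shows "ennreal ((U p' - U p)\<^sup>2) \<le> 40 * 16 ^ k * cell_double_energy U k z"
proof -
  let ?D = "dyadic_cell (Suc k) z" and ?E = "cell_double_energy U k z"
  have D: "dyadic_cell k p = dyadic_cell k z" "dyadic_cell (Suc k) p' = ?D"
    using p p' dyadic_cell_eq by auto
  have "ennreal ((U p' - U p)\<^sup>2) * ennreal (1 / 4 ^ Suc k)
      = (\<integral>\<^sup>+b. ennreal ((U p' - U p)\<^sup>2) * indicator ?D b \<partial>lborel)"
    by (subst nn_integral_cmult_indicator) (simp_all add: emeasure_dyadic_cell)
  also have "\<dots> \<le> (\<integral>\<^sup>+b. 2 * (ennreal ((U p' - U b)\<^sup>2) * indicator ?D b)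
      + 2 * (ennreal ((U p - U b)\<^sup>2) * indicator (dyadic_cell k z) b) \<partial>lborel)"
  proof (intro nn_integral_mono)
    fix b
    have "(U p' - U p)\<^sup>2 \<le> 2 * (U p' - U b)\<^sup>2 + 2 * (U p - U b)\<^sup>2"
      using sum_squares_bound[of "U p' - U b" "U b - U p"] by (simp add: power2_eq_square algebra_simps)
    then have "ennreal ((U p' - U p)\<^sup>2) \<le> 2 * ennreal ((U p' - U b)\<^sup>2) + 2 * ennreal ((U p - U b)\<^sup>2)"
      by (simp add: ennreal_plus[symmetric] ennreal_mult[symmetric] ennreal_leI flip: ennreal_numeral del: ennreal_plus)
    then show "ennreal ((U p' - U p)\<^sup>2) * indicator ?D b \<le> 2 * (ennreal ((U p' - U b)\<^sup>2) * indicator ?D b)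
      + 2 * (ennreal ((U p - U b)\<^sup>2) * indicator (dyadic_cell k z) b)"
      using subsetD[OF dyadic_cell_Suc_subset, of b k z] by (auto simp: indicator_def)
  qed
  also have "\<dots> = 2 * cell_energy U (Suc k) p' + 2 * cell_energy U k p"
    unfolding cell_energy_def D
    by (subst nn_integral_add) (simp_all add: nn_integral_cmult)
  also have "\<dots> \<le> 2 * (4 ^ Suc k * ?E) + 2 * (4 ^ k * ?E)"
    by (intro add_mono mult_left_mono p order_trans[OF p'(2)] cell_double_energy_Suc_le) simp_all
  also have "\<dots> = 10 * 4 ^ k * ?E"
  proof -
    have "2 * (4 * x) + 2 * x = (8 + 2) * x" for x :: ennreal
      unfolding distrib_right by (simp add: mult.assoc[symmetric])
    from this[of "4 ^ k * ?E"] show ?thesis by (simp add: mult.assoc)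
  qed
  finally have *: "ennreal ((U p' - U p)\<^sup>2) * ennreal (1 / 4 ^ Suc k) \<le> 10 * 4 ^ k * ?E" .
  have "ennreal ((U p' - U p)\<^sup>2) = 4 ^ Suc k * (ennreal ((U p' - U p)\<^sup>2) * ennreal (1 / 4 ^ Suc k))"
    using ennreal_power_mult_inverse[of "Suc k"] by (metis mult.commute mult.left_commute mult_1)
  also have "\<dots> \<le> 4 ^ Suc k * (10 * 4 ^ k * ?E)"
    by (intro mult_left_mono *) simp
  also have "\<dots> = 40 * 16 ^ k * ?E"
    using power_mult_distrib[of "4::ennreal" 4 k] by (simp add: ac_simps)
  finally show ?thesis .
qed

lemma sum_power_le:
  fixes w :: real assumes "0 < w" "w < 1"
  shows "(\<Sum>k<n. w ^ k) \<le> 1 / (1 - w)"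
proof -
  have "(\<Sum>k<n. w ^ k) = (1 - w ^ n) / (1 - w)"
    using assms by (simp add: sum_gp_strict)
  also have "\<dots> \<le> 1 / (1 - w)" using assms by (intro divide_right_mono) auto
  finally show ?thesis .
qed

text \<open>
  The telescoping sum of the jumps ends at \<open>U z = 0\<close> by continuity. Cauchy-Schwarz with the weights
  \<open>w ^ k\<close> turns it into a sum of squares; \<open>w\<close> is chosen later in terms of \<open>s\<close>.
\<close>

lemma good_point_near_zero:
  assumes cont: "continuous_on UNIV U" and z: "U z = 0"
    and p: "p \<in> dyadic_cell 0 z" "cell_energy U 0 p \<le> cell_double_energy U 0 z"
    and w: "0 < w" "w < 1"
  shows "ennreal ((U p)\<^sup>2)
      \<le> ennreal (1 / (1 - w)) * (\<Sum>k. ennreal (1 / w ^ k) * (40 * 16 ^ k * cell_double_energy U k z))"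
proof -
  let ?T = "\<lambda>k. ennreal (1 / w ^ k) * (40 * 16 ^ k * cell_double_energy U k z)"
  have [measurable]: "U \<in> borel_measurable borel"
    using cont by (rule borel_measurable_continuous_onI)
  obtain P0 where P0: "\<And>k. P0 k \<in> dyadic_cell k z"
      "\<And>k. cell_energy U k (P0 k) \<le> 4 ^ k * cell_double_energy U k z"
    using exists_good_point[of U _ z] by (metis \<open>U \<in> borel_measurable borel\<close>)
  define P where "P k = (if k = 0 then p else P0 k)" for k
  have P: "P k \<in> dyadic_cell k z" "cell_energy U k (P k) \<le> 4 ^ k * cell_double_energy U k z" for k
    using P0 p by (auto simp: P_def)
  define d where "d k = U (P (Suc k)) - U (P k)" for k
  have d: "ennreal ((d k)\<^sup>2) \<le> 40 * 16 ^ k * cell_double_energy U k z" for k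
    unfolding d_def by (intro good_point_jump P) measurable
  have "(\<lambda>n. norm (P n - z)) \<longlonglongrightarrow> 0"
  proof (rule tendsto_sandwich[of "\<lambda>_. 0" _ _ "\<lambda>n. 2 * (1 / 2) ^ n"])
    show "(\<lambda>n. 2 * (1 / 2) ^ n :: real) \<longlonglongrightarrow> 0"
      using tendsto_mult_right_zero[OF LIMSEQ_power_zero[of "1/2::real"]] by simp
    show "\<forall>\<^sub>F n in sequentially. norm (P n - z) \<le> 2 * (1 / 2) ^ n"
      using dist_dyadic_cell[OF P(1)] by (simp add: power_one_over)
  qed auto
  then have "P \<longlonglongrightarrow> z"
    by (simp add: LIM_zero_cancel tendsto_norm_zero_iff)
  then have "(\<lambda>n. U (P n)) \<longlonglongrightarrow> U z"
    using cont by (intro continuous_on_tendsto_compose[of UNIV U]) auto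
  then have lim: "(\<lambda>n. ennreal ((U (P n) - U p)\<^sup>2)) \<longlonglongrightarrow> ennreal ((U z - U p)\<^sup>2)"
    by (intro tendsto_intros)
  have bound: "ennreal ((U (P n) - U p)\<^sup>2) \<le> ennreal (1 / (1 - w)) * (\<Sum>k. ?T k)" for n
  proof -
    have "U (P n) - U p = (\<Sum>k<n. d k)"
      unfolding d_def by (subst sum_lessThan_telescope) (simp add: P_def)
    also have "\<dots> = (\<Sum>k<n. sqrt (w ^ k) * (d k / sqrt (w ^ k)))"
      using w by simp
    finally have telescope: "U (P n) - U p = (\<Sum>k<n. sqrt (w ^ k) * (d k / sqrt (w ^ k)))" .
    have "(U (P n) - U p)\<^sup>2 \<le> (\<Sum>k<n. (sqrt (w ^ k))\<^sup>2) * (\<Sum>k<n. (d k / sqrt (w ^ k))\<^sup>2)"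
      unfolding telescope by (rule Cauchy_Schwarz_ineq_sum)
    also have "\<dots> = (\<Sum>k<n. w ^ k) * (\<Sum>k<n. 1 / w ^ k * (d k)\<^sup>2)"
      using w by (simp add: power_divide)
    also have "\<dots> \<le> 1 / (1 - w) * (\<Sum>k<n. 1 / w ^ k * (d k)\<^sup>2)"
      using w by (intro mult_right_mono sum_power_le sum_nonneg) auto
    finally have "ennreal ((U (P n) - U p)\<^sup>2) \<le> ennreal (1 / (1 - w) * (\<Sum>k<n. 1 / w ^ k * (d k)\<^sup>2))"
      by (rule ennreal_leI)
    also have "\<dots> = ennreal (1 / (1 - w)) * (\<Sum>k<n. ennreal (1 / w ^ k) * ennreal ((d k)\<^sup>2))"
    proof -
      have "ennreal (1 / w ^ k) * ennreal ((d k)\<^sup>2) = ennreal (1 / w ^ k * (d k)\<^sup>2)" for k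
        using w by (intro ennreal_mult[symmetric]) auto
      moreover have "(\<Sum>k<n. ennreal (1 / w ^ k * (d k)\<^sup>2)) = ennreal (\<Sum>k<n. 1 / w ^ k * (d k)\<^sup>2)"
        using w by (intro sum_ennreal) auto
      ultimately show ?thesis
        using w by (simp only: ennreal_mult sum_nonneg zero_le_power2 zero_le_divide_1_iff zero_le_power
            less_imp_le zero_le_mult_iff diff_ge_0_iff_ge simp_thms)
    qed
    also have "\<dots> \<le> ennreal (1 / (1 - w)) * (\<Sum>k<n. ?T k)"
      by (intro mult_left_mono sum_mono d) auto
    also have "\<dots> \<le> ennreal (1 / (1 - w)) * (\<Sum>k. ?T k)"
      by (intro mult_left_mono sum_le_suminf) auto
    finally show ?thesis .
  qed
  have "ennreal ((U z - U p)\<^sup>2) \<le> ennreal (1 / (1 - w)) * (\<Sum>k. ?T k)"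
    using LIMSEQ_le_const2[OF lim] bound by blast
  then show ?thesis using z by simp
qed

section \<open>The Poincare inequality on a unit cell\<close>

text \<open>
  The row and the column of cells of level \<open>k\<close> through \<open>a\<close>. If \<open>z\<close> shares a coordinate with \<open>a\<close>, then
  the cell of \<open>z\<close> lies in the cross of \<open>a\<close>, whatever the other coordinate of \<open>z\<close> is.
\<close>

definition dyadic_cross :: "nat \<Rightarrow> real \<times> real \<Rightarrow> (real \<times> real) set" where
  "dyadic_cross k a = {b. \<lfloor>2 ^ k * fst b\<rfloor> = \<lfloor>2 ^ k * fst a\<rfloor> \<or> \<lfloor>2 ^ k * snd b\<rfloor> = \<lfloor>2 ^ k * snd a\<rfloor>}"

lemma dyadic_cross_sym: "b \<in> dyadic_cross k a \<longleftrightarrow> a \<in> dyadic_cross k b"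
  by (auto simp: dyadic_cross_def)

lemma measurable_indicator_dyadic_cross [measurable]:
  assumes [measurable]: "f \<in> borel_measurable M" "g \<in> borel_measurable M"
  shows "(\<lambda>x. indicator (dyadic_cross k (f x)) (g x) :: ennreal) \<in> borel_measurable M"
proof -
  note [measurable] = borel_measurable_components[OF assms(1)] borel_measurable_components[OF assms(2)]
  have "Measurable.pred M (\<lambda>x. g x \<in> dyadic_cross k (f x))"
    unfolding dyadic_cross_def mem_Collect_eq by measurable
  then show ?thesis
    by (simp add: indicator_def)
qed

lemma emeasure_dyadic_cross_le:
  "(\<integral>\<^sup>+a. indicator (dyadic_cross k b) a * indicator (dyadic_cell 0 x) a \<partial>lborel) \<le> ennreal (2 / 2 ^ k)"
proof -
  define A where "A c = {t::real. \<lfloor>2 ^ k * t\<rfloor> = \<lfloor>2 ^ k * c\<rfloor>}" for c :: real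
  define I where "I c = {t::real. \<lfloor>2 ^ 0 * t\<rfloor> = \<lfloor>2 ^ 0 * c\<rfloor>}" for c :: real
  have A: "A c \<in> sets borel" "emeasure lborel (A c) = ennreal (1 / 2 ^ k)" for c
    unfolding A_def using emeasure_floor_scaled_fibre[of k] by simp_all
  have I: "I c \<in> sets borel" "emeasure lborel (I c) = 1" for c
    unfolding I_def using emeasure_floor_scaled_fibre[of 0] by simp_all
  have sets: "A c \<times> I d \<in> sets lborel" "I d \<times> A c \<in> sets lborel" for c d
    using A I by (simp_all add: lborel_prod[symmetric] pair_measureI)
  have "(\<integral>\<^sup>+a. indicator (dyadic_cross k b) a * indicator (dyadic_cell 0 x) a \<partial>lborel)
      \<le> (\<integral>\<^sup>+a. indicator (A (fst b) \<times> I (snd x)) a + indicator (I (fst x) \<times> A (snd b)) a \<partial>lborel)"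
    by (intro nn_integral_mono)
      (auto simp: indicator_def A_def I_def dyadic_cross_def dyadic_cell_def)
  also have "\<dots> = emeasure lborel (A (fst b) \<times> I (snd x)) + emeasure lborel (I (fst x) \<times> A (snd b))"
    using sets by (subst nn_integral_add) auto
  also have "\<dots> = ennreal (1 / 2 ^ k) + ennreal (1 / 2 ^ k)"
    using A I by (simp add: emeasure_lborel_Times)
  also have "\<dots> = ennreal (2 / 2 ^ k)"
    by (simp add: ennreal_plus[symmetric] del: ennreal_plus)
  finally show ?thesis .
qed

text \<open>
  Tonelli: a point \<open>b\<close> of the unit cell lies in the cross of \<open>a\<close> exactly when \<open>a\<close> lies in the cross of
  \<open>b\<close>, whose part in the unit cell has area at most \<open>2 / 2 ^ k\<close>.
\<close>

lemma nn_integral_over_crosses_le: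
  assumes [measurable]: "f \<in> borel_measurable borel"
  shows "(\<integral>\<^sup>+a. (\<integral>\<^sup>+b. f b * indicator (dyadic_cross k a) b * indicator (dyadic_cell 0 x) b \<partial>lborel)
      * indicator (dyadic_cell 0 x) a \<partial>lborel)
    \<le> ennreal (2 / 2 ^ k) * (\<integral>\<^sup>+b. f b * indicator (dyadic_cell 0 x) b \<partial>lborel)"
proof -
  have "(\<integral>\<^sup>+a. (\<integral>\<^sup>+b. f b * indicator (dyadic_cross k a) b * indicator (dyadic_cell 0 x) b \<partial>lborel)
      * indicator (dyadic_cell 0 x) a \<partial>lborel)
    = (\<integral>\<^sup>+a. (\<integral>\<^sup>+b. f b * indicator (dyadic_cell 0 x) b * (indicator (dyadic_cross k b) a
      * indicator (dyadic_cell 0 x) a) \<partial>lborel) \<partial>lborel)"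
  proof (intro nn_integral_cong)
    fix a
    have "(\<integral>\<^sup>+b. f b * indicator (dyadic_cross k a) b * indicator (dyadic_cell 0 x) b \<partial>lborel)
        * indicator (dyadic_cell 0 x) a
      = (\<integral>\<^sup>+b. f b * indicator (dyadic_cross k a) b * indicator (dyadic_cell 0 x) b
        * indicator (dyadic_cell 0 x) a \<partial>lborel)"
      by (intro nn_integral_multc[symmetric]) simp
    also have "\<dots> = (\<integral>\<^sup>+b. f b * indicator (dyadic_cell 0 x) b * (indicator (dyadic_cross k b) a
      * indicator (dyadic_cell 0 x) a) \<partial>lborel)"
      by (intro nn_integral_cong) (simp add: indicator_def dyadic_cross_sym)
    finally show "(\<integral>\<^sup>+b. f b * indicator (dyadic_cross k a) b * indicator (dyadic_cell 0 x) b \<partial>lborel)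
        * indicator (dyadic_cell 0 x) a
      = (\<integral>\<^sup>+b. f b * indicator (dyadic_cell 0 x) b * (indicator (dyadic_cross k b) a
      * indicator (dyadic_cell 0 x) a) \<partial>lborel)" .
  qed
  also have "\<dots> = (\<integral>\<^sup>+b. (\<integral>\<^sup>+a. f b * indicator (dyadic_cell 0 x) b * (indicator (dyadic_cross k b) a
      * indicator (dyadic_cell 0 x) a) \<partial>lborel) \<partial>lborel)"
    by (rule lborel_pair.Fubini') simp
  also have "\<dots> = (\<integral>\<^sup>+b. f b * indicator (dyadic_cell 0 x) b
      * (\<integral>\<^sup>+a. indicator (dyadic_cross k b) a * indicator (dyadic_cell 0 x) a \<partial>lborel) \<partial>lborel)"
    by (intro nn_integral_cong nn_integral_cmult) simp
  also have "\<dots> \<le> (\<integral>\<^sup>+b. f b * indicator (dyadic_cell 0 x) b * ennreal (2 / 2 ^ k) \<partial>lborel)"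
    by (intro nn_integral_mono mult_left_mono emeasure_dyadic_cross_le) simp
  also have "\<dots> = ennreal (2 / 2 ^ k) * (\<integral>\<^sup>+b. f b * indicator (dyadic_cell 0 x) b \<partial>lborel)"
    by (subst nn_integral_multc) (simp_all add: mult.commute)
  finally show ?thesis .
qed

text \<open>
  The chosen point \<open>p\<close> of the unit cell is independent of the zero to which it is connected. Hence
  the bound for \<open>U p\<close> by the energies near a zero, with cells enlarged to crosses, can be integrated
  over all points of \<open>S\<close>; this bounds \<open>U p\<close>, and the difference between \<open>U\<close> and \<open>U p\<close> is
  controlled by the double energy of the unit cell itself.
\<close>

lemma unit_cell_poincare:
  fixes U :: "real \<times> real \<Rightarrow> real"
  assumes cont: "continuous_on UNIV U" and w: "0 < w" "w < 1"
    and S: "S \<in> sets borel" "S \<subseteq> dyadic_cell 0 x" "emeasure lborel S \<ge> ennreal (1 / 20)"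
    and zeros: "\<And>a. a \<in> S \<Longrightarrow> \<exists>z\<in>dyadic_cell 0 x. U z = 0 \<and> (fst z = fst a \<or> snd z = snd a)"
  shows "(\<integral>\<^sup>+y. ennreal ((U y)\<^sup>2) * indicator (dyadic_cell 0 x) y \<partial>lborel)
    \<le> ennreal (3202 / (1 - w)) *
      (\<Sum>k. ennreal ((8 / w) ^ k) * (\<integral>\<^sup>+a. cell_energy U k a * indicator (dyadic_cell 0 x) a \<partial>lborel))"
proof -
  let ?Q = "dyadic_cell 0 x"
  define I where "I k = (\<integral>\<^sup>+a. cell_energy U k a * indicator ?Q a \<partial>lborel)" for k
  define X where "X k a = (\<integral>\<^sup>+b. cell_energy U k b * indicator (dyadic_cross k a) b * indicator ?Q b \<partial>lborel)" for k a
  define W where "W = ennreal (1 / (1 - w))"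
  define \<Sigma> where "\<Sigma> = (\<Sum>k. ennreal ((8 / w) ^ k) * I k)"
  have mU [measurable]: "U \<in> borel_measurable borel"
    using cont by (rule borel_measurable_continuous_onI)
  have [measurable]: "X k \<in> borel_measurable borel" for k
    unfolding X_def by measurable
  obtain p where p: "p \<in> ?Q" "cell_energy U 0 p \<le> cell_double_energy U 0 x"
    using exists_good_point[OF mU, of 0 x] by auto
  \<comment> \<open>The right-hand side no longer mentions the zero, only the point \<open>a\<close> in its row or column.\<close>
  have pointwise: "ennreal ((U p)\<^sup>2) \<le> W * (\<Sum>k. ennreal (1 / w ^ k) * (40 * 16 ^ k * X k a))" if aS: "a \<in> S" for a
  proof -
    obtain z where z: "z \<in> ?Q" "U z = 0" "fst z = fst a \<or> snd z = snd a"
      using zeros[OF aS] by blast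
    have Qz: "dyadic_cell 0 z = ?Q" using z dyadic_cell_eq by blast
    have "cell_double_energy U k z \<le> X k a" for k
      unfolding cell_double_energy_def X_def
    proof (intro nn_integral_mono)
      fix b
      have "b \<in> ?Q" if "b \<in> dyadic_cell k z"
        using subsetD[OF dyadic_cell_subset_0 that] Qz by simp
      moreover have "b \<in> dyadic_cross k a" if "b \<in> dyadic_cell k z"
        using that z(3) by (auto simp: dyadic_cross_def dyadic_cell_def)
      ultimately show "cell_energy U k b * indicator (dyadic_cell k z) b
         \<le> cell_energy U k b * indicator (dyadic_cross k a) b * indicator (dyadic_cell 0 x) b"
        by (auto simp: indicator_def)
    qed
    moreover have "ennreal ((U p)\<^sup>2)
      \<le> W * (\<Sum>k. ennreal (1 / w ^ k) * (40 * 16 ^ k * cell_double_energy U k z))"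
      unfolding W_def using p Qz
      by (intro good_point_near_zero cont z w) (auto simp: cell_double_energy_def)
    ultimately show ?thesis
      by (elim order_trans) (intro mult_left_mono suminf_le; simp)
  qed
  have "ennreal ((U p)\<^sup>2) * ennreal (1 / 20) \<le> ennreal ((U p)\<^sup>2) * emeasure lborel S"
    by (intro mult_left_mono S) simp
  also have "\<dots> = (\<integral>\<^sup>+a. ennreal ((U p)\<^sup>2) * indicator S a \<partial>lborel)"
    using S by (subst nn_integral_cmult_indicator) auto
  also have "\<dots> \<le> (\<integral>\<^sup>+a. W * (\<Sum>k. ennreal (1 / w ^ k) * (40 * 16 ^ k * X k a)) * indicator ?Q a \<partial>lborel)"
    using pointwise S(2) by (intro nn_integral_mono) (auto simp: indicator_def)
  also have "\<dots> = (\<integral>\<^sup>+a. W * (\<Sum>k. ennreal (1 / w ^ k) * (40 * 16 ^ k * (X k a * indicator ?Q a))) \<partial>lborel)"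
    by (intro nn_integral_cong) (simp add: mult.assoc indicator_def)
  also have "\<dots> = W * (\<Sum>k. ennreal (1 / w ^ k) * (40 * 16 ^ k * (\<integral>\<^sup>+a. X k a * indicator ?Q a \<partial>lborel)))"
    by (simp add: nn_integral_cmult nn_integral_suminf)
  also have "\<dots> \<le> W * (\<Sum>k. ennreal (1 / w ^ k) * (40 * 16 ^ k * (ennreal (2 / 2 ^ k) * I k)))"
    unfolding X_def I_def
    by (intro mult_left_mono suminf_le nn_integral_over_crosses_le) simp_all
  also have "\<dots> = W * (80 * \<Sigma>)"
  proof -
    have "ennreal (1 / w ^ k) * (40 * 16 ^ k * (ennreal (2 / 2 ^ k) * I k)) = 80 * (ennreal ((8 / w) ^ k) * I k)" for k
    proof -
      have "(40::ennreal) * 16 ^ k = ennreal (40 * 16 ^ k)"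
        by (simp add: ennreal_mult ennreal_power[symmetric] del: ennreal_power)
      then have "ennreal (1 / w ^ k) * (40 * 16 ^ k * ennreal (2 / 2 ^ k))
          = ennreal (1 / w ^ k * (40 * 16 ^ k * (2 / 2 ^ k)))"
        using w by (simp add: ennreal_mult[symmetric] del: ennreal_power)
      also have "1 / w ^ k * (40 * 16 ^ k * (2 / 2 ^ k)) = 80 * (8 / w) ^ k"
        using w power_mult_distrib[of "2::real" 8 k] by (simp add: power_divide)
      also have "ennreal (80 * (8 / w) ^ k) = 80 * ennreal ((8 / w) ^ k)"
        using w by (simp add: ennreal_mult)
      finally have factors: "ennreal (1 / w ^ k) * (40 * 16 ^ k * ennreal (2 / 2 ^ k)) = 80 * ennreal ((8 / w) ^ k)" .
      have "ennreal (1 / w ^ k) * (40 * 16 ^ k * (ennreal (2 / 2 ^ k) * I k))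
          = (ennreal (1 / w ^ k) * (40 * 16 ^ k * ennreal (2 / 2 ^ k))) * I k"
        by (simp only: mult.assoc)
      also have "\<dots> = 80 * ennreal ((8 / w) ^ k) * I k"
        by (simp only: factors)
      also have "\<dots> = 80 * (ennreal ((8 / w) ^ k) * I k)"
        by (rule mult.assoc)
      finally show ?thesis .
    qed
    then show ?thesis by (simp add: \<Sigma>_def)
  qed
  finally have "ennreal ((U p)\<^sup>2) * ennreal (1 / 20) \<le> W * (80 * \<Sigma>)" .
  then have "20 * (ennreal ((U p)\<^sup>2) * ennreal (1 / 20)) \<le> 20 * (W * (80 * \<Sigma>))"
    by (intro mult_left_mono) auto
  moreover have "20 * (ennreal ((U p)\<^sup>2) * ennreal (1 / 20)) = ennreal ((U p)\<^sup>2)"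
    by (simp add: ennreal_mult[symmetric] flip: ennreal_numeral)
  ultimately have Up: "ennreal ((U p)\<^sup>2) \<le> 1600 * (W * \<Sigma>)"
    by (simp add: mult.left_commute flip: mult.assoc)
  \<comment> \<open>The energy of the whole unit cell is the first term of the series.\<close>
  have "I 0 \<le> W * \<Sigma>"
  proof -
    have "1 \<le> W" unfolding W_def using w by (auto simp: field_simps)
    moreover have "I 0 \<le> \<Sigma>"
      unfolding \<Sigma>_def using sum_le_suminf[of "\<lambda>k. ennreal ((8 / w) ^ k) * I k" "{0}"] by simp
    ultimately show ?thesis using mult_mono[of 1 W "I 0" \<Sigma>] by simp
  qed
  have "(\<integral>\<^sup>+y. ennreal ((U y)\<^sup>2) * indicator ?Q y \<partial>lborel)
      \<le> (\<integral>\<^sup>+y. 2 * (ennreal ((U p - U y)\<^sup>2) * indicator ?Q y) + 2 * (ennreal ((U p)\<^sup>2) * indicator ?Q y) \<partial>lborel)"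
  proof (intro nn_integral_mono)
    fix y
    have "(U y)\<^sup>2 \<le> 2 * (U p - U y)\<^sup>2 + 2 * (U p)\<^sup>2"
      using zero_le_power2[of "2 * U p - U y"] by (simp add: power2_eq_square algebra_simps)
    then have "ennreal ((U y)\<^sup>2) \<le> 2 * ennreal ((U p - U y)\<^sup>2) + 2 * ennreal ((U p)\<^sup>2)"
      by (simp add: ennreal_plus[symmetric] ennreal_mult[symmetric] ennreal_leI flip: ennreal_numeral del: ennreal_plus)
    then show "ennreal ((U y)\<^sup>2) * indicator ?Q y \<le>
        2 * (ennreal ((U p - U y)\<^sup>2) * indicator ?Q y) + 2 * (ennreal ((U p)\<^sup>2) * indicator ?Q y)"
      by (auto simp: indicator_def)
  qed
  also have "\<dots> = 2 * cell_energy U 0 p + 2 * ennreal ((U p)\<^sup>2)"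
    using dyadic_cell_eq[OF p(1)]
    by (subst nn_integral_add) (simp_all add: nn_integral_cmult nn_integral_cmult_indicator
        emeasure_dyadic_cell cell_energy_def)
  also have "\<dots> \<le> 2 * (W * \<Sigma>) + 2 * (1600 * (W * \<Sigma>))"
    using p(2) \<open>I 0 \<le> W * \<Sigma>\<close> Up
    by (intro add_mono mult_left_mono) (auto simp: cell_double_energy_def I_def)
  also have "\<dots> = 3202 * (W * \<Sigma>)"
  proof -
    have "2 * t + 2 * (1600 * t) = (2 + 3200) * t" for t :: ennreal
      unfolding distrib_right by (simp add: mult.assoc[symmetric])
    then show ?thesis by simp
  qed
  also have "\<dots> = ennreal (3202 / (1 - w)) * \<Sigma>"
  proof -
    have "3202 * W = ennreal (3202 * (1 / (1 - w)))"
      unfolding W_def using w by (subst ennreal_mult) auto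
    then show ?thesis by (simp add: mult.assoc[symmetric])
  qed
  finally show ?thesis unfolding \<Sigma>_def I_def .
qed

text \<open>
  Averaging over the position \<open>x\<close> instead of summing over the countably many unit cells; it works
  because each cell has area 1.
\<close>

lemma nn_integral_over_unit_cells:
  assumes [measurable]: "f \<in> borel_measurable borel"
  shows "(\<integral>\<^sup>+x. (\<integral>\<^sup>+y. f y * indicator (dyadic_cell 0 x) y \<partial>lborel) \<partial>lborel) = (\<integral>\<^sup>+y. f y \<partial>lborel)"
proof -
  have "(\<integral>\<^sup>+x. (\<integral>\<^sup>+y. f y * indicator (dyadic_cell 0 x) y \<partial>lborel) \<partial>lborel)
    = (\<integral>\<^sup>+y. (\<integral>\<^sup>+x. f y * indicator (dyadic_cell 0 x) y \<partial>lborel) \<partial>lborel)"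
    by (rule lborel_pair.Fubini'[symmetric]) simp
  also have "\<dots> = (\<integral>\<^sup>+y. (\<integral>\<^sup>+x. f y * indicator (dyadic_cell 0 y) x \<partial>lborel) \<partial>lborel)"
    by (intro nn_integral_cong) (simp add: indicator_def dyadic_cell_sym)
  also have "\<dots> = (\<integral>\<^sup>+y. f y \<partial>lborel)"
    by (simp add: nn_integral_cmult_indicator emeasure_dyadic_cell)
  finally show ?thesis .
qed

lemma poincare_cell_energies:
  fixes U :: "real \<times> real \<Rightarrow> real"
  assumes cont: "continuous_on UNIV U" and w: "0 < w" "w < 1"
    and S: "\<And>x. \<exists>S\<in>sets borel. S \<subseteq> dyadic_cell 0 x \<and> emeasure lborel S \<ge> ennreal (1 / 20) \<and>
      (\<forall>a\<in>S. \<exists>z\<in>dyadic_cell 0 x. U z = 0 \<and> (fst z = fst a \<or> snd z = snd a))"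
  shows "(\<integral>\<^sup>+y. ennreal ((U y)\<^sup>2) \<partial>lborel)
    \<le> ennreal (3202 / (1 - w)) * (\<Sum>k. ennreal ((8 / w) ^ k) * (\<integral>\<^sup>+a. cell_energy U k a \<partial>lborel))"
proof -
  have [measurable]: "U \<in> borel_measurable borel"
    using cont by (rule borel_measurable_continuous_onI)
  have "(\<integral>\<^sup>+y. ennreal ((U y)\<^sup>2) \<partial>lborel)
      = (\<integral>\<^sup>+x. (\<integral>\<^sup>+y. ennreal ((U y)\<^sup>2) * indicator (dyadic_cell 0 x) y \<partial>lborel) \<partial>lborel)"
    by (subst nn_integral_over_unit_cells) simp_all
  also have "\<dots> \<le> (\<integral>\<^sup>+x. ennreal (3202 / (1 - w)) *
      (\<Sum>k. ennreal ((8 / w) ^ k) * (\<integral>\<^sup>+a. cell_energy U k a * indicator (dyadic_cell 0 x) a \<partial>lborel)) \<partial>lborel)"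
  proof (intro nn_integral_mono)
    fix x
    obtain S where "S\<in>sets borel" "S \<subseteq> dyadic_cell 0 x" "emeasure lborel S \<ge> ennreal (1 / 20)"
      "\<And>a. a\<in>S \<Longrightarrow> \<exists>z\<in>dyadic_cell 0 x. U z = 0 \<and> (fst z = fst a \<or> snd z = snd a)"
      using S[of x] by blast
    then show "(\<integral>\<^sup>+y. ennreal ((U y)\<^sup>2) * indicator (dyadic_cell 0 x) y \<partial>lborel)
    \<le> ennreal (3202 / (1 - w)) *
      (\<Sum>k. ennreal ((8 / w) ^ k) * (\<integral>\<^sup>+a. cell_energy U k a * indicator (dyadic_cell 0 x) a \<partial>lborel))"
      by (intro unit_cell_poincare[OF cont w])
  qed
  also have "\<dots> = ennreal (3202 / (1 - w)) * (\<Sum>k. ennreal ((8 / w) ^ k) *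
      (\<integral>\<^sup>+x. (\<integral>\<^sup>+a. cell_energy U k a * indicator (dyadic_cell 0 x) a \<partial>lborel) \<partial>lborel))"
    by (simp add: nn_integral_cmult nn_integral_suminf)
  also have "\<dots> = ennreal (3202 / (1 - w)) * (\<Sum>k. ennreal ((8 / w) ^ k) * (\<integral>\<^sup>+a. cell_energy U k a \<partial>lborel))"
    by (simp add: nn_integral_over_unit_cells)
  finally show ?thesis .
qed

section \<open>Increments at dyadic scales\<close>

lemma nn_integral_lborel_translate:
  fixes f :: "'a::euclidean_space \<Rightarrow> ennreal"
  assumes [measurable]: "f \<in> borel_measurable borel"
  shows "(\<integral>\<^sup>+x. f (c + x) \<partial>lborel) = (\<integral>\<^sup>+x. f x \<partial>lborel)"
  by (subst lborel_distr_plus[of c, symmetric]) (simp add: nn_integral_distr)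

lemma nn_integral_lborel_scale:
  fixes f :: "'a::euclidean_space \<Rightarrow> ennreal"
  assumes [measurable]: "f \<in> borel_measurable borel" and c: "c > 0"
  shows "(\<integral>\<^sup>+x. f x \<partial>lborel) = ennreal (c ^ DIM('a)) * (\<integral>\<^sup>+x. f (c *\<^sub>R x) \<partial>lborel)"
  using c by (subst lborel_affine[of c 0]) (simp_all add: nn_integral_density nn_integral_distr nn_integral_cmult)

definition shift_energy :: "('a::euclidean_space \<Rightarrow> real) \<Rightarrow> 'a \<Rightarrow> ennreal" where
  "shift_energy U h = (\<integral>\<^sup>+x. ennreal ((U (x + h) - U x)\<^sup>2) \<partial>lborel)"

definition ball_energy :: "('a::euclidean_space \<Rightarrow> real) \<Rightarrow> real \<Rightarrow> ennreal" where
  "ball_energy U \<rho> = (\<integral>\<^sup>+h. shift_energy U h * indicator (cball 0 \<rho>) h \<partial>lborel)"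

lemma measurable_shift_energy [measurable]:
  fixes U :: "'a::euclidean_space \<Rightarrow> real"
  assumes [measurable]: "U \<in> borel_measurable borel"
  shows "shift_energy U \<in> borel_measurable borel"
  unfolding shift_energy_def by measurable

lemma shift_energy_double_le:
  fixes U :: "'a::euclidean_space \<Rightarrow> real"
  assumes [measurable]: "U \<in> borel_measurable borel"
  shows "shift_energy U (2 *\<^sub>R h) \<le> 4 * shift_energy U h"
proof -
  have "shift_energy U (2 *\<^sub>R h) \<le>
      (\<integral>\<^sup>+x. 2 * ennreal ((U (h + x + h) - U (h + x))\<^sup>2) + 2 * ennreal ((U (x + h) - U x)\<^sup>2) \<partial>lborel)"
    unfolding shift_energy_def
  proof (intro nn_integral_mono)
    fix x
    have eq: "x + 2 *\<^sub>R h = h + x + h" by (simp add: scaleR_2)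
    have "(U (h + x + h) - U x)\<^sup>2 \<le> 2 * (U (h + x + h) - U (h + x))\<^sup>2 + 2 * (U (x + h) - U x)\<^sup>2"
      using sum_squares_bound[of "U (h + x + h) - U (h + x)" "U (h + x) - U x"]
      by (simp add: power2_eq_square algebra_simps)
    then show "ennreal ((U (x + 2 *\<^sub>R h) - U x)\<^sup>2)
        \<le> 2 * ennreal ((U (h + x + h) - U (h + x))\<^sup>2) + 2 * ennreal ((U (x + h) - U x)\<^sup>2)"
      unfolding eq
      by (simp add: ennreal_plus[symmetric] ennreal_mult[symmetric] ennreal_leI flip: ennreal_numeral del: ennreal_plus)
  qed
  also have "\<dots> = 2 * (\<integral>\<^sup>+x. ennreal ((U (h + x + h) - U (h + x))\<^sup>2) \<partial>lborel) + 2 * shift_energy U h"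
    unfolding shift_energy_def by (subst nn_integral_add) (simp_all add: nn_integral_cmult)
  also have "(\<integral>\<^sup>+x. ennreal ((U (h + x + h) - U (h + x))\<^sup>2) \<partial>lborel) = shift_energy U h"
    unfolding shift_energy_def
    using nn_integral_lborel_translate[of "\<lambda>x. ennreal ((U (x + h) - U x)\<^sup>2)" h] by simp
  also have "2 * shift_energy U h + 2 * shift_energy U h = 4 * shift_energy U h"
    by (simp flip: distrib_right)
  finally show ?thesis .
qed

lemma measurable_cball [measurable]: "cball (a :: 'a::euclidean_space) r \<in> sets borel"
  by (simp add: borel_closed)

lemma ball_energy_double_le:
  fixes U :: "'a::euclidean_space \<Rightarrow> real"
  assumes [measurable]: "U \<in> borel_measurable borel"
  shows "ball_energy U (2 * \<rho>) \<le> ennreal (4 * 2 ^ DIM('a)) * ball_energy U \<rho>"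
proof -
  have "ball_energy U (2 * \<rho>)
    = ennreal (2 ^ DIM('a)) * (\<integral>\<^sup>+h. shift_energy U (2 *\<^sub>R h) * indicator (cball 0 (2 * \<rho>)) (2 *\<^sub>R h) \<partial>lborel)"
    unfolding ball_energy_def
    by (rule nn_integral_lborel_scale)
      (auto intro!: borel_measurable_times_ennreal measurable_shift_energy borel_measurable_indicator measurable_cball assms)
  also have "\<dots> \<le> ennreal (2 ^ DIM('a)) * (\<integral>\<^sup>+h. 4 * (shift_energy U h * indicator (cball 0 \<rho>) h) \<partial>lborel)"
    using shift_energy_double_le[OF assms]
    by (intro mult_left_mono nn_integral_mono) (auto simp: indicator_def)
  also have "\<dots> = ennreal (2 ^ DIM('a)) * (4 * ball_energy U \<rho>)"
    unfolding ball_energy_def by (subst nn_integral_cmult) simp_all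
  also have "\<dots> = ennreal (4 * 2 ^ DIM('a)) * ball_energy U \<rho>"
    by (subst ennreal_mult) (simp_all add: ac_simps)
  finally show ?thesis .
qed

lemma nn_integral_shift_variables:
  fixes F :: "'a::euclidean_space \<Rightarrow> 'a \<Rightarrow> ennreal"
  assumes [measurable]: "case_prod F \<in> borel_measurable (lborel \<Otimes>\<^sub>M lborel)"
  shows "(\<integral>\<^sup>+x. (\<integral>\<^sup>+y. F x y \<partial>lborel) \<partial>lborel) = (\<integral>\<^sup>+h. (\<integral>\<^sup>+x. F x (x + h) \<partial>lborel) \<partial>lborel)"
proof -
  have "(\<integral>\<^sup>+x. (\<integral>\<^sup>+y. F x y \<partial>lborel) \<partial>lborel) = (\<integral>\<^sup>+x. (\<integral>\<^sup>+h. F x (x + h) \<partial>lborel) \<partial>lborel)"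
    by (intro nn_integral_cong nn_integral_lborel_translate[symmetric]) simp
  also have "\<dots> = (\<integral>\<^sup>+h. (\<integral>\<^sup>+x. F x (x + h) \<partial>lborel) \<partial>lborel)"
    by (rule lborel_pair.Fubini') simp
  finally show ?thesis .
qed

text \<open>
  The partial sums of a geometric sequence with ratio at least 2 are bounded by twice their last
  term.
\<close>

lemma geometric_sum_bounded_terms:
  fixes c Y :: real
  assumes c: "c \<ge> 2" and Y: "Y \<ge> 0"
  shows "(\<Sum>k<n. if c ^ k \<le> Y then c ^ k else 0) \<le> 2 * Y"
proof (induction n)
  case (Suc n)
  have geo: "(\<Sum>k<m. c ^ k) \<le> c ^ m" for m
  proof (induction m)
    case (Suc m)
    have "(\<Sum>k<Suc m. c ^ k) \<le> 2 * c ^ m" using Suc by simp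
    also have "\<dots> \<le> c * c ^ m" using c by (intro mult_right_mono) auto
    finally show ?case by simp
  qed simp
  show ?case
  proof (cases "c ^ n \<le> Y")
    case True
    have "(\<Sum>k<Suc n. if c ^ k \<le> Y then c ^ k else 0) \<le> (\<Sum>k<Suc n. c ^ k)"
      using c by (intro sum_mono) auto
    also have "\<dots> \<le> 2 * c ^ n" using geo[of n] by simp
    finally show ?thesis using True by simp
  qed (use Suc in simp)
qed (use Y in simp)

text \<open>
  For a fixed increment \<open>h\<close> only the scales with \<open>2 ^ k \<le> 2 / \<bar>h\<bar>\<close> contribute, and the last of these
  terms, of size \<open>(2 / \<bar>h\<bar>) powr e\<close>, dominates the sum.
\<close>

lemma suminf_ball_energy_le:
  fixes U :: "'a::euclidean_space \<Rightarrow> real"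
  assumes [measurable]: "U \<in> borel_measurable borel" and e: "e \<ge> 1"
  shows "(\<Sum>k. ennreal ((2 powr e) ^ k) * ball_energy U (2 / 2 ^ k)) \<le>
    ennreal (2 * 2 powr e) *
      (\<integral>\<^sup>+x. (\<integral>\<^sup>+y. ennreal ((U x - U y)\<^sup>2 / norm (x - y) powr e) \<partial>lborel) \<partial>lborel)"
proof -
  have kernel: "(\<Sum>k. ennreal ((2 powr e) ^ k) * indicator (cball 0 (2 / 2 ^ k)) h) \<le>
    ennreal (2 * 2 powr e) * ennreal (1 / norm h powr e)" if "h \<noteq> 0" for h :: 'a
  proof (rule suminf_le_const)
    fix n
    have "ennreal ((2 powr e) ^ k) * indicator (cball 0 (2 / 2 ^ k)) h
        = ennreal (if (2 powr e) ^ k \<le> (2 / norm h) powr e then (2 powr e) ^ k else 0)" for k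
    proof -
      have "norm h \<le> 2 / 2 ^ k \<longleftrightarrow> 2 ^ k \<le> 2 / norm h"
        using that by (simp add: field_simps)
      also have "\<dots> \<longleftrightarrow> (2 ^ k) powr e \<le> (2 / norm h) powr e"
        using e that powr_mono2[of e "2 ^ k" "2 / norm h"] powr_less_mono2[of e "2 / norm h" "2 ^ k"]
        by (auto simp: not_le[symmetric])
      also have "(2 ^ k) powr e = (2 powr e) ^ k"
        by (simp add: powr_realpow[symmetric] powr_powr mult.commute)
      finally show ?thesis by (simp add: indicator_def)
    qed
    then have "(\<Sum>k<n. ennreal ((2 powr e) ^ k) * indicator (cball 0 (2 / 2 ^ k)) h)
      = ennreal (\<Sum>k<n. if (2 powr e) ^ k \<le> (2 / norm h) powr e then (2 powr e) ^ k else 0)"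
      by (simp add: sum_ennreal)
    also have "\<dots> \<le> ennreal (2 * (2 / norm h) powr e)"
      using powr_mono[of 1 e "2::real"] e by (intro ennreal_leI geometric_sum_bounded_terms) auto
    also have "\<dots> = ennreal (2 * 2 powr e) * ennreal (1 / norm h powr e)"
      using that by (simp add: powr_divide ennreal_mult[symmetric])
    finally show "(\<Sum>k<n. ennreal ((2 powr e) ^ k) * indicator (cball 0 (2 / 2 ^ k)) h)
      \<le> ennreal (2 * 2 powr e) * ennreal (1 / norm h powr e)" .
  qed simp
  have "(\<Sum>k. ennreal ((2 powr e) ^ k) * ball_energy U (2 / 2 ^ k))
    = (\<integral>\<^sup>+h. shift_energy U h * (\<Sum>k. ennreal ((2 powr e) ^ k) * indicator (cball 0 (2 / 2 ^ k)) h) \<partial>lborel)"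
  proof -
    have "(\<Sum>k. ennreal ((2 powr e) ^ k) * ball_energy U (2 / 2 ^ k))
      = (\<Sum>k. \<integral>\<^sup>+h. ennreal ((2 powr e) ^ k) * (shift_energy U h * indicator (cball 0 (2 / 2 ^ k)) h) \<partial>lborel)"
      unfolding ball_energy_def by (intro suminf_cong nn_integral_cmult[symmetric]) measurable
    also have "\<dots> = (\<integral>\<^sup>+h. (\<Sum>k. ennreal ((2 powr e) ^ k) *
        (shift_energy U h * indicator (cball 0 (2 / 2 ^ k)) h)) \<partial>lborel)"
      by (intro nn_integral_suminf[symmetric]) measurable
    also have "\<dots> = (\<integral>\<^sup>+h. (\<Sum>k. shift_energy U h *
        (ennreal ((2 powr e) ^ k) * indicator (cball 0 (2 / 2 ^ k)) h)) \<partial>lborel)"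
      by (simp only: mult.left_commute)
    finally show ?thesis by simp
  qed
  also have "\<dots> \<le> (\<integral>\<^sup>+h. ennreal (2 * 2 powr e) * (shift_energy U h * ennreal (1 / norm h powr e)) \<partial>lborel)"
  proof (intro nn_integral_mono)
    fix h :: 'a
    show "shift_energy U h * (\<Sum>k. ennreal ((2 powr e) ^ k) * indicator (cball 0 (2 / 2 ^ k)) h)
       \<le> ennreal (2 * 2 powr e) * (shift_energy U h * ennreal (1 / norm h powr e))"
    proof (cases "h = 0")
      case True
      \<comment> \<open>All balls contain 0, so the series of the kernel diverges; the energy of the zero shift vanishes.\<close>
      then show ?thesis by (simp add: shift_energy_def)
    next
      case False
      then show ?thesis
        using mult_left_mono[OF kernel[OF False], of "shift_energy U h"] by (simp add: ac_simps)
    qed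
  qed
  also have "\<dots> = ennreal (2 * 2 powr e) * (\<integral>\<^sup>+h. shift_energy U h * ennreal (1 / norm h powr e) \<partial>lborel)"
    by (subst nn_integral_cmult) simp_all
  also have "(\<integral>\<^sup>+h. shift_energy U h * ennreal (1 / norm h powr e) \<partial>lborel)
    = (\<integral>\<^sup>+h. (\<integral>\<^sup>+x. ennreal ((U x - U (x + h))\<^sup>2 / norm (x - (x + h)) powr e) \<partial>lborel) \<partial>lborel)"
    unfolding shift_energy_def
    by (simp add: nn_integral_multc[symmetric] ennreal_mult[symmetric] power2_commute)
  also have "\<dots> = (\<integral>\<^sup>+x. (\<integral>\<^sup>+y. ennreal ((U x - U y)\<^sup>2 / norm (x - y) powr e) \<partial>lborel) \<partial>lborel)"
    by (rule nn_integral_shift_variables[symmetric]) simp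
  finally show ?thesis .
qed

lemma nn_integral_cell_energy_le:
  assumes [measurable]: "U \<in> borel_measurable borel"
  shows "(\<integral>\<^sup>+a. cell_energy U k a \<partial>lborel) \<le> ball_energy U (2 / 2 ^ k)"
proof -
  have "(\<integral>\<^sup>+a. cell_energy U k a \<partial>lborel)
    \<le> (\<integral>\<^sup>+x. (\<integral>\<^sup>+y. ennreal ((U x - U y)\<^sup>2) * indicator (cball 0 (2 / 2 ^ k)) (y - x) \<partial>lborel) \<partial>lborel)"
    unfolding cell_energy_def
    using dist_dyadic_cell by (intro nn_integral_mono) (auto simp: indicator_def)
  also have "\<dots> = (\<integral>\<^sup>+h. (\<integral>\<^sup>+x. ennreal ((U x - U (x + h))\<^sup>2) * indicator (cball 0 (2 / 2 ^ k)) (x + h - x) \<partial>lborel) \<partial>lborel)"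
    by (rule nn_integral_shift_variables) measurable
  also have "\<dots> = ball_energy U (2 / 2 ^ k)"
    unfolding ball_energy_def shift_energy_def
    by (simp add: nn_integral_multc power2_commute)
  finally show ?thesis .
qed

section \<open>Comparison of weighted sums and the dependence on the order\<close>

text \<open>
  By summation by parts \<open>(1 - p) \<Sum> p ^ k a\<^sub>k\<close> is the sum of \<open>p ^ k\<close> times the increments of \<open>a\<close>, which
  are nonnegative, and \<open>p ^ k \<le> q ^ k\<close>.
\<close>

lemma abel_weighted_sum_le:
  fixes a :: "nat \<Rightarrow> ennreal"
  assumes mono: "\<And>k. a k \<le> a (Suc k)" and pq: "0 < p" "p \<le> q" "q < 1"
  shows "ennreal (1 - p) * (\<Sum>k. ennreal (p ^ k) * a k) \<le> ennreal (1 - q) * (\<Sum>k. ennreal (q ^ k) * a k)"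
proof (cases "(\<Sum>k. ennreal (q ^ k) * a k) = top")
  case True
  then show ?thesis using pq by (simp add: ennreal_mult_top)
next
  case False
  have "ennreal (q ^ k) * a k \<noteq> top" for k
    using False sum_le_suminf[of "\<lambda>k. ennreal (q ^ k) * a k" "{k}"] by (auto simp: top_unique)
  then have fin: "a k \<noteq> top" for k
    using pq by (metis ennreal_mult_top ennreal_eq_0_iff not_le zero_less_power less_le_trans)
  define r where "r k = enn2real (a k)" for k
  have a: "a k = ennreal (r k)" and r0: "r k \<ge> 0" for k
    using fin[of k] by (simp_all add: r_def less_top)
  have r: "r k \<le> r (Suc k)" for k
    using mono[of k] r0 unfolding a by simp
  have fq: "summable (\<lambda>k. q ^ k * r k)"
    using False pq r0 by (intro summable_suminf_not_top) (auto simp: a ennreal_mult)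
  have fp: "summable (\<lambda>k. p ^ k * r k)"
    by (rule summable_comparison_test'[OF fq, of 0]) (use pq r0 in \<open>auto intro!: mult_right_mono power_mono\<close>)
  \<comment> \<open>Including the boundary term, each side grows by \<open>p ^ Suc n\<close> or \<open>q ^ Suc n\<close> times an increment of \<open>r\<close>.\<close>
  have "(1 - p) * (\<Sum>k<n. p ^ k * r k) + p ^ n * r n \<le> (1 - q) * (\<Sum>k<n. q ^ k * r k) + q ^ n * r n" for n
  proof (induction n)
    case (Suc n)
    have "p * p ^ n * (r (Suc n) - r n) \<le> q * q ^ n * (r (Suc n) - r n)"
      using pq r[of n] by (intro mult_right_mono mult_mono power_mono) auto
    with Suc show ?case by (simp add: algebra_simps)
  qed simp
  then have partial: "(1 - p) * (\<Sum>k<n. p ^ k * r k) \<le> (1 - q) * (\<Sum>k<n. q ^ k * r k) + q ^ n * r n" for n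
    using pq r0 by (smt (verit) mult_nonneg_nonneg zero_le_power)
  have "(1 - p) * (\<Sum>k. p ^ k * r k) \<le> (1 - q) * (\<Sum>k. q ^ k * r k) + 0"
    by (rule LIMSEQ_le[OF tendsto_mult_left[OF summable_LIMSEQ[OF fp]]
        tendsto_add[OF tendsto_mult_left[OF summable_LIMSEQ[OF fq]] summable_LIMSEQ_zero[OF fq]]])
      (use partial in blast)
  then have "ennreal ((1 - p) * (\<Sum>k. p ^ k * r k)) \<le> ennreal ((1 - q) * (\<Sum>k. q ^ k * r k))"
    by (simp add: ennreal_leI)
  moreover have "(\<Sum>k. ennreal (v ^ k) * a k) = ennreal (\<Sum>k. v ^ k * r k)"
    if "summable (\<lambda>k. v ^ k * r k)" "0 < v" for v
    using that r0 by (simp add: a ennreal_mult[symmetric] suminf_ennreal2)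
  ultimately show ?thesis
    using fp fq pq r0 by (simp add: ennreal_mult suminf_nonneg)
qed

lemma half_power_gap:
  assumes "0 \<le> t" "t \<le> 1/2"
  shows "t / 3 \<le> 1 - 2 powr (- t :: real)"
proof -
  define l where "l = t * ln 2"
  have l: "2/3 * t \<le> l" "l \<le> 1/2"
    using assms ln2_ge_two_thirds ln2_le_25_over_36 mult_mono[of t "1/2" "ln 2" "25/36"]
      mult_left_mono[of "2/3" "ln 2" t] by (auto simp: l_def mult.commute)
  have l0: "0 \<le> l" using assms by (simp add: l_def)
  have "(1 + l) * 2 powr (- t) \<le> exp l * 2 powr (- t)"
    by (intro mult_right_mono exp_ge_add_one_self) simp
  also have "\<dots> = 1" by (simp add: powr_def l_def flip: exp_add)
  finally have "2 powr (- t) \<le> 1 / (1 + l)" using l0 by (simp add: field_simps)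
  moreover have "1 / (1 + l) \<le> 1 - t / 3"
  proof -
    have "t / 3 * (1 + l) \<le> t / 3 * (3 / 2)" using l assms by (intro mult_left_mono) auto
    then have "t / 3 * (1 + l) \<le> l" using l assms by linarith
    then show ?thesis using l0 by (simp add: field_simps)
  qed
  ultimately show ?thesis by linarith
qed

text \<open>
  The weight \<open>w = 2 powr (1/2 - s)\<close> puts the chains half way between the critical order \<open>1/2\<close> and \<open>s\<close>.
  So \<open>1 / (1 - w)\<close> is of the order of \<open>1 / (s - 1/2)\<close>, while \<open>p = 1 / (2 * w)\<close> stays away from 1
  and the comparison with \<open>q = 4 powr (s - 1)\<close> gains the factor \<open>1 - q\<close>, of the order of \<open>1 - s\<close>.
\<close>

lemma fractional_poincare_unit_scale:
  fixes U :: "real \<times> real \<Rightarrow> real"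
  assumes cont: "continuous_on UNIV U" and s: "1/2 < s" "s < 1"
    and S: "\<And>x. \<exists>S\<in>sets borel. S \<subseteq> dyadic_cell 0 x \<and> emeasure lborel S \<ge> ennreal (1 / 20) \<and>
      (\<forall>a\<in>S. \<exists>z\<in>dyadic_cell 0 x. U z = 0 \<and> (fst z = fst a \<or> snd z = snd a))"
  shows "(\<integral>\<^sup>+y. ennreal ((U y)\<^sup>2) \<partial>lborel)
    \<le> ennreal (4000000 * (1 - s) / (s - 1/2)) *
      (\<integral>\<^sup>+x. (\<integral>\<^sup>+y. ennreal ((U x - U y)\<^sup>2 / norm (x - y) powr (2 + 2 * s)) \<partial>lborel) \<partial>lborel)"
    (is "_ \<le> _ * ?G")
proof -
  define w :: real where "w = 2 powr (- (s - 1/2))"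
  define p where "p = 1 / (2 * w)"
  define q :: real where "q = 2 powr (2 + 2 * s) / 16"
  define a where "a k = ennreal (16 ^ k) * ball_energy U (2 / 2 ^ k)" for k
  have mU [measurable]: "U \<in> borel_measurable borel"
    using cont by (rule borel_measurable_continuous_onI)
  have w: "0 < w" "w < 1" using s powr_less_mono[of "- (s - 1/2)" 0 "2::real"] by (auto simp: w_def)
  have w_gap: "(s - 1/2) / 3 \<le> 1 - w" unfolding w_def using s by (intro half_power_gap) auto
  have p_eq: "p = 2 powr (s - 3/2)"
  proof -
    have "2 * w = 2 powr (3/2 - s)"
      using powr_add[of 2 1 "- (s - 1/2)"] by (simp add: w_def)
    then show ?thesis
      unfolding p_def using powr_minus_divide[of 2 "3/2 - s"] by simp
  qed
  have q_eq: "q = 2 powr (2 * s - 2)"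
    unfolding q_def using powr_diff[of 2 "2 + 2 * s" 4] by simp
  have p_gap: "1/6 \<le> 1 - p"
  proof -
    have "p \<le> 2 powr (- (1/2))" unfolding p_eq using s by (intro powr_mono) auto
    then show ?thesis using half_power_gap[of "1/2"] by simp
  qed
  have pq: "0 < p" "p \<le> q" "q < 1"
    using w s powr_less_mono[of "2 * s - 2" 0 "2::real"] by (auto simp: p_eq q_eq intro!: powr_mono)
  have q_gap: "1 - q \<le> 2 * (1 - s)"
  proof -
    have "1 + (2 * s - 2) * ln 2 \<le> q"
      unfolding q_eq powr_def using exp_ge_add_one_self[of "(2 * s - 2) * ln 2"] by simp
    moreover have "(2 - 2 * s) * ln 2 \<le> (2 - 2 * s) * 1"
      using s ln2_le_25_over_36 by (intro mult_left_mono) auto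
    ultimately show ?thesis by (simp add: algebra_simps)
  qed
  have incr: "a k \<le> a (Suc k)" for k
  proof -
    have "a k \<le> ennreal (16 ^ k) * (ennreal 16 * ball_energy U (2 / 2 ^ Suc k))"
      unfolding a_def using ball_energy_double_le[OF mU, of "2 / 2 ^ Suc k"] by (intro mult_left_mono) simp_all
    also have "\<dots> = a (Suc k)"
      unfolding a_def by (simp add: ennreal_mult mult.assoc mult.left_commute)
    finally show ?thesis .
  qed
  have "(\<integral>\<^sup>+y. ennreal ((U y)\<^sup>2) \<partial>lborel)
      \<le> ennreal (3202 / (1 - w)) * (\<Sum>k. ennreal ((8 / w) ^ k) * (\<integral>\<^sup>+a. cell_energy U k a \<partial>lborel))"
    by (rule poincare_cell_energies[OF cont w S])
  also have "\<dots> \<le> ennreal (3202 / (1 - w)) * (\<Sum>k. ennreal ((8 / w) ^ k) * ball_energy U (2 / 2 ^ k))"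
    by (intro mult_left_mono suminf_le nn_integral_cell_energy_le) simp_all
  also have "(\<Sum>k. ennreal ((8 / w) ^ k) * ball_energy U (2 / 2 ^ k)) = (\<Sum>k. ennreal (p ^ k) * a k)"
  proof (intro suminf_cong)
    fix k
    have "(8 / w) ^ k = p ^ k * 16 ^ k"
      unfolding p_def power_mult_distrib[symmetric] by (simp add: field_simps)
    then show "ennreal ((8 / w) ^ k) * ball_energy U (2 / 2 ^ k) = ennreal (p ^ k) * a k"
      using pq unfolding a_def by (simp only: ennreal_mult zero_le_power less_imp_le mult.assoc)
  qed
  also have "\<dots> \<le> ennreal (6 * (1 - q)) * (\<Sum>k. ennreal (q ^ k) * a k)"
  proof -
    have "(\<Sum>k. ennreal (p ^ k) * a k) = ennreal 6 * (ennreal (1/6) * (\<Sum>k. ennreal (p ^ k) * a k))"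
    proof -
      have "ennreal 6 * ennreal (1/6) = 1" by (subst ennreal_mult[symmetric]) simp_all
      then show ?thesis by (simp only: mult.assoc[symmetric] mult_1)
    qed
    also have "\<dots> \<le> ennreal 6 * (ennreal (1 - p) * (\<Sum>k. ennreal (p ^ k) * a k))"
      by (intro mult_left_mono mult_right_mono ennreal_leI p_gap) simp_all
    also have "\<dots> \<le> ennreal 6 * (ennreal (1 - q) * (\<Sum>k. ennreal (q ^ k) * a k))"
      by (intro mult_left_mono abel_weighted_sum_le incr pq) simp
    also have "\<dots> = ennreal (6 * (1 - q)) * (\<Sum>k. ennreal (q ^ k) * a k)"
      using pq by (subst ennreal_mult) (simp_all add: mult.assoc)
    finally show ?thesis .
  qed
  also have "(\<Sum>k. ennreal (q ^ k) * a k) = (\<Sum>k. ennreal ((2 powr (2 + 2 * s)) ^ k) * ball_energy U (2 / 2 ^ k))"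
  proof (intro suminf_cong)
    fix k
    have "(2 powr (2 + 2 * s)) ^ k = q ^ k * 16 ^ k"
      unfolding q_def power_mult_distrib[symmetric] by simp
    then show "ennreal (q ^ k) * a k = ennreal ((2 powr (2 + 2 * s)) ^ k) * ball_energy U (2 / 2 ^ k)"
      using pq unfolding a_def by (simp add: ennreal_mult mult.assoc del: ennreal_power)
  qed
  also have "\<dots> \<le> ennreal (2 * 2 powr (2 + 2 * s)) * ?G"
    using s by (intro suminf_ball_energy_le mU) auto
  finally have "(\<integral>\<^sup>+y. ennreal ((U y)\<^sup>2) \<partial>lborel) \<le>
      ennreal (3202 / (1 - w)) * (ennreal (6 * (1 - q)) * (ennreal (2 * 2 powr (2 + 2 * s)) * ?G))"
    by (simp add: mult_left_mono)
  also have "\<dots> = ennreal (3202 / (1 - w) * (6 * (1 - q)) * (2 * 2 powr (2 + 2 * s))) * ?G"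
  proof -
    have nonneg: "0 \<le> 3202 / (1 - w)" "0 \<le> 6 * (1 - q)" "0 \<le> 2 * 2 powr (2 + 2 * s)"
      using w pq by auto
    have "ennreal a * (ennreal b * (ennreal c * x)) = ennreal (a * b * c) * x"
      if "0 \<le> a" "0 \<le> b" "0 \<le> c" for a b c x
      using that by (simp add: ennreal_mult mult.assoc)
    then show ?thesis using nonneg by blast
  qed
  also have "\<dots> \<le> ennreal (4000000 * (1 - s) / (s - 1/2)) * ?G"
  proof (intro mult_right_mono ennreal_leI)
    have "3202 / (1 - w) \<le> 3202 / ((s - 1/2) / 3)"
      using w_gap s by (intro divide_left_mono) auto
    moreover have "2 powr (2 + 2 * s) \<le> 16"
      using powr_mono[of "2 + 2 * s" 4 "2::real"] s by simp
    ultimately have "3202 / (1 - w) * (6 * (1 - q)) * (2 * 2 powr (2 + 2 * s))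
      \<le> 3202 / ((s - 1/2) / 3) * (6 * (2 * (1 - s))) * (2 * 16)"
      using s w pq q_gap by (intro mult_mono) auto
    also have "\<dots> = 3688704 * ((1 - s) / (s - 1/2))"
      using s by (simp add: field_simps)
    also have "\<dots> \<le> 4000000 * ((1 - s) / (s - 1/2))"
      using s by (intro mult_right_mono) auto
    finally show "3202 / (1 - w) * (6 * (1 - q)) * (2 * 2 powr (2 + 2 * s)) \<le> 4000000 * (1 - s) / (s - 1/2)"
      by simp
  qed simp
  finally show ?thesis .
qed

section \<open>Zeros in every unit cell\<close>

lemma unbounded_connected_meets_squares:
  fixes E :: "(real \<times> real) set"
  assumes E: "connected E" "\<not> bounded E" "x \<in> E" and \<rho>: "0 \<le> \<rho>"
  shows "\<exists>z\<in>E. max \<bar>fst z - fst x\<bar> \<bar>snd z - snd x\<bar> = \<rho>"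
proof -
  let ?f = "\<lambda>z. max \<bar>fst z - fst x\<bar> \<bar>snd z - snd x\<bar>"
  have "connected (?f ` E)"
    by (intro connected_continuous_image E continuous_intros)
  moreover have "0 \<in> ?f ` E" using E(3) by force
  moreover obtain z where "z \<in> E" "?f z > \<rho>"
  proof (rule ccontr)
    assume "\<not> thesis"
    with that have le: "?f z \<le> \<rho>" if "z \<in> E" for z
      using \<open>z \<in> E\<close> by (meson not_le)
    have "E \<subseteq> cball x (2 * \<rho>)"
    proof
      fix z assume "z \<in> E"
      have "norm (z - x) \<le> \<bar>fst z - fst x\<bar> + \<bar>snd z - snd x\<bar>"
        using norm_Pair_le[of "fst z - fst x" "snd z - snd x"] by (simp add: minus_prod_def)
      then show "z \<in> cball x (2 * \<rho>)"
        using le[OF \<open>z \<in> E\<close>] by (simp add: dist_norm norm_minus_commute)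
    qed
    then show False using E(2) bounded_subset[OF bounded_cball] by blast
  qed
  ultimately have "\<rho> \<in> ?f ` E"
    using \<rho> connectedD_interval[of "?f ` E" 0 "?f z" \<rho>] by auto
  then show ?thesis by auto
qed

text \<open>
  The four reflected and translated copies of \<open>P1\<close> and \<open>P2\<close> cover \<open>{0..r}\<close>.
\<close>

lemma projections_cover:
  assumes P: "P1 \<in> sets borel" "P2 \<in> sets borel" and "0 \<le> r"
    and cover: "\<And>\<rho>. 0 \<le> \<rho> \<Longrightarrow> \<rho> \<le> r \<Longrightarrow> a + \<rho> \<in> P1 \<or> a - \<rho> \<in> P1 \<or> b + \<rho> \<in> P2 \<or> b - \<rho> \<in> P2"
  shows "ennreal r \<le> 2 * emeasure lborel P1 + 2 * emeasure lborel (P2 :: real set)"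
proof -
  have affine: "(\<integral>\<^sup>+\<rho>. indicator P (c + \<rho>) \<partial>lborel) = emeasure lborel P"
    "(\<integral>\<^sup>+\<rho>. indicator P (c - \<rho>) \<partial>lborel) = emeasure lborel P" if "P \<in> sets borel" for P :: "real set" and c
    using nn_integral_real_affine[of "indicator P" 1 c] nn_integral_real_affine[of "indicator P" "-1" c] that
    by simp_all
  note [measurable] = P
  have "ennreal r = (\<integral>\<^sup>+\<rho>. indicator {0..r} \<rho> \<partial>lborel)"
    using \<open>0 \<le> r\<close> by simp
  also have "\<dots> \<le> (\<integral>\<^sup>+\<rho>. (indicator P1 (a + \<rho>) + indicator P1 (a - \<rho>))
      + (indicator P2 (b + \<rho>) + indicator P2 (b - \<rho>)) \<partial>lborel)"
    using cover by (intro nn_integral_mono) (fastforce simp: indicator_def)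
  also have "\<dots> = (emeasure lborel P1 + emeasure lborel P1) + (emeasure lborel P2 + emeasure lborel P2)"
    using P by (subst nn_integral_add; simp add: nn_integral_add affine)
  finally show ?thesis by (simp flip: mult_2)
qed

text \<open>
  If \<open>y\<close> is within \<open>1/4\<close> of the centre of the cell, the square contours of radius at most \<open>1/5\<close>
  round \<open>y\<close> stay at distance \<open>1/20\<close> from its boundary. Each of them meets \<open>E\<close> on one of its
  four sides, which gives a point in one of the projections of \<open>Z\<close> at distance \<open>\<rho>\<close> from the
  corresponding coordinate of \<open>y\<close>. So one of the two projections has length at least \<open>1/20\<close>.
\<close>

lemma zeros_in_unit_cell:
  fixes Z :: "(real \<times> real) set"
  assumes Z: "closed Z" "E \<subseteq> Z" and E: "connected E" "\<not> bounded E" "y \<in> E"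
    and y: "\<bar>fst y - (\<lfloor>fst x\<rfloor> + 1/2)\<bar> \<le> 1/4" "\<bar>snd y - (\<lfloor>snd x\<rfloor> + 1/2)\<bar> \<le> 1/4"
  shows "\<exists>S\<in>sets borel. S \<subseteq> dyadic_cell 0 x \<and> emeasure lborel S \<ge> ennreal (1 / 20) \<and>
      (\<forall>a\<in>S. \<exists>z\<in>dyadic_cell 0 x. z \<in> Z \<and> (fst z = fst a \<or> snd z = snd a))"
proof -
  define m n where "m = real_of_int \<lfloor>fst x\<rfloor>" and "n = real_of_int \<lfloor>snd x\<rfloor>"
  \<comment> \<open>A closed box makes \<open>K\<close> compact, so that its projections are Borel sets.\<close>
  define K where "K = Z \<inter> cbox (m + 1/20, n + 1/20) (m + 19/20, n + 19/20)"
  have floor_m: "\<lfloor>t\<rfloor> = \<lfloor>fst x\<rfloor> \<longleftrightarrow> m \<le> t \<and> t < m + 1" for t unfolding m_def by linarith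
  have floor_n: "\<lfloor>t\<rfloor> = \<lfloor>snd x\<rfloor> \<longleftrightarrow> n \<le> t \<and> t < n + 1" for t unfolding n_def by linarith
  have Q: "dyadic_cell 0 x = {m..<m+1} \<times> {n..<n+1}"
    by (auto simp: dyadic_cell_def floor_m floor_n)
  have KQ: "K \<subseteq> dyadic_cell 0 x"
    by (auto simp: K_def Q cbox_Pair_eq)
  have "compact K"
    unfolding K_def using Z by (intro closed_Int_compact compact_cbox)
  then have P: "fst ` K \<in> sets borel" "snd ` K \<in> sets borel"
    by (auto intro!: borel_compact compact_continuous_image continuous_intros)
  have "fst y + \<rho> \<in> fst ` K \<or> fst y - \<rho> \<in> fst ` K \<or> snd y + \<rho> \<in> snd ` K \<or> snd y - \<rho> \<in> snd ` K"
    if \<rho>: "0 \<le> \<rho>" "\<rho> \<le> 1/5" for \<rho>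
  proof -
    obtain z where z: "z \<in> E" "max \<bar>fst z - fst y\<bar> \<bar>snd z - snd y\<bar> = \<rho>"
      using unbounded_connected_meets_squares[OF E \<rho>(1)] by blast
    have "\<bar>fst z - fst y\<bar> \<le> 1/5" "\<bar>snd z - snd y\<bar> \<le> 1/5"
      using z(2) \<rho> by linarith+
    then have "m + 1/20 \<le> fst z" "fst z \<le> m + 19/20" "n + 1/20 \<le> snd z" "snd z \<le> n + 19/20"
      using y unfolding m_def n_def by linarith+
    then have "z \<in> K"
      using z(1) Z by (cases z) (auto simp: K_def cbox_Pair_eq)
    then have "fst z \<in> fst ` K" "snd z \<in> snd ` K" by auto
    moreover have "fst z = fst y + \<rho> \<or> fst z = fst y - \<rho> \<or> snd z = snd y + \<rho> \<or> snd z = snd y - \<rho>"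
      using z(2) by linarith
    ultimately show ?thesis by metis
  qed
  then have cover: "ennreal (1/5) \<le> 2 * emeasure lborel (fst ` K) + 2 * emeasure lborel (snd ` K)"
    by (intro projections_cover[OF P, of "1/5" "fst y" "snd y"]) auto
  define S where "S = fst ` K \<times> {n..<n+1} \<union> {m..<m+1} \<times> snd ` K"
  have sets: "fst ` K \<times> {n..<n+1} \<in> sets borel" "{m..<m+1} \<times> snd ` K \<in> sets borel"
    unfolding borel_prod[symmetric] using P by (auto intro!: pair_measureI)
  have S: "S \<in> sets borel"
    unfolding S_def using sets by auto
  have large: "ennreal (1/20) \<le> emeasure lborel S"
  proof (rule ccontr)
    assume "\<not> ?thesis"
    then have "emeasure lborel S < ennreal (1/20)" by simp
    moreover have "emeasure lborel (fst ` K) \<le> emeasure lborel S"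
      using emeasure_mono[of "fst ` K \<times> {n..<n+1}" S lborel] S P by (simp add: S_def emeasure_lborel_Times)
    moreover have "emeasure lborel (snd ` K) \<le> emeasure lborel S"
      using emeasure_mono[of "{m..<m+1} \<times> snd ` K" S lborel] S P by (simp add: S_def emeasure_lborel_Times)
    ultimately have "2 * emeasure lborel (fst ` K) + 2 * emeasure lborel (snd ` K)
        < 2 * ennreal (1/20) + 2 * ennreal (1/20)"
      by (intro add_strict_mono ennreal_mult_strict_left_mono) auto
    also have "\<dots> = ennreal (1/5)"
      by (simp add: ennreal_mult[symmetric] ennreal_plus[symmetric] flip: ennreal_numeral del: ennreal_plus)
    finally show False using cover by simp
  qed
  show ?thesis
  proof (intro bexI[OF _ S] conjI large ballI)
    show "S \<subseteq> dyadic_cell 0 x"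
      using KQ by (auto simp: S_def Q)
    fix a assume "a \<in> S"
    then obtain z where "z \<in> K" "fst z = fst a \<or> snd z = snd a"
      by (auto simp: S_def)
    then show "\<exists>z\<in>dyadic_cell 0 x. z \<in> Z \<and> (fst z = fst a \<or> snd z = snd a)"
      using KQ by (auto simp: K_def)
  qed
qed

text \<open>
  Identifies \<open>\<real> \<times> \<real>\<close>, where Lebesgue measure is a product, with \<open>real ^ 2\<close>, and rescales so that the
  grid of side \<open>L\<close> becomes the unit grid.
\<close>

definition plane_map :: "real \<Rightarrow> real \<times> real \<Rightarrow> real ^ 2" where
  "plane_map L p = (\<chi> i. L * (if i = 1 then fst p else snd p))"

lemma plane_map_nth [simp]: "plane_map L p $ 1 = L * fst p" "plane_map L p $ 2 = L * snd p"
  by (simp_all add: plane_map_def)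

lemma continuous_plane_map: "continuous_on A (plane_map L)"
proof -
  have "continuous_on A (\<lambda>p::real \<times> real. L * (if i = (1::2) then fst p else snd p))" for i
    by (cases "i = 1") (auto intro!: continuous_intros)
  then show ?thesis unfolding plane_map_def by (intro continuous_on_vec_lambda)
qed

lemma measurable_plane_map [measurable]: "plane_map L \<in> borel \<rightarrow>\<^sub>M borel"
  by (intro borel_measurable_continuous_onI continuous_plane_map)

lemma plane_map_surj: "L \<noteq> 0 \<Longrightarrow> plane_map L (v $ 1 / L, v $ 2 / L) = v"
  by (simp add: vec_eq_iff forall_2)

lemma norm_vec_2: "norm (v :: real ^ 2) = sqrt ((v $ 1)\<^sup>2 + (v $ 2)\<^sup>2)"
  by (simp add: norm_vec_def L2_set_def sum_2)

lemma norm_plane_map_diff: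
  assumes "L > 0"
  shows "norm (plane_map L p - plane_map L q) = L * norm (p - q)"
proof -
  have "norm (plane_map L p - plane_map L q) = sqrt (L\<^sup>2 * ((fst (p - q))\<^sup>2 + (snd (p - q))\<^sup>2))"
    by (simp add: norm_vec_2 power2_eq_square algebra_simps)
  also have "\<dots> = L * norm (p - q)"
    using assms by (simp add: real_sqrt_mult norm_prod_def)
  finally show ?thesis .
qed

lemma lborel_plane_map:
  assumes L: "L > 0"
  shows "lborel = density (distr lborel borel (plane_map L)) (\<lambda>_. ennreal (L\<^sup>2))"
proof (rule lborel_eqI)
  fix l u :: "real ^ 2"
  assume le: "\<And>b. b \<in> Basis \<Longrightarrow> l \<bullet> b \<le> u \<bullet> b"
  have Basis2: "Basis = {axis 1 1, axis 2 (1::real) :: real ^ 2}"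
    by (auto simp: Basis_vec_def UNIV_2)
  have le12: "l $ 1 \<le> u $ 1" "l $ 2 \<le> u $ 2"
    using le[of "axis 1 1"] le[of "axis 2 1"] by (auto simp: Basis2 inner_axis)
  have vimage: "plane_map L -` box l u = {l $ 1 / L <..< u $ 1 / L} \<times> {l $ 2 / L <..< u $ 2 / L}"
    using L by (auto simp: mem_box_cart forall_2 field_simps)
  have "emeasure (density (distr lborel borel (plane_map L)) (\<lambda>_. ennreal (L\<^sup>2))) (box l u)
      = ennreal (L\<^sup>2) * emeasure lborel (plane_map L -` box l u)"
    by (simp add: emeasure_density nn_integral_cmult_indicator emeasure_distr)
  also have "\<dots> = ennreal (L\<^sup>2) * (ennreal (u $ 1 / L - l $ 1 / L) * ennreal (u $ 2 / L - l $ 2 / L))"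
    unfolding vimage using le12 L by (subst emeasure_lborel_Times) (simp_all add: divide_right_mono)
  also have "\<dots> = ennreal (L\<^sup>2 * ((u $ 1 / L - l $ 1 / L) * (u $ 2 / L - l $ 2 / L)))"
    using le12 L by (simp add: ennreal_mult divide_right_mono)
  also have "L\<^sup>2 * ((u $ 1 / L - l $ 1 / L) * (u $ 2 / L - l $ 2 / L)) = (u $ 1 - l $ 1) * (u $ 2 - l $ 2)"
    using L by (simp add: power2_eq_square field_simps)
  also have "\<dots> = (\<Prod>b\<in>Basis. (u - l) \<bullet> b)"
    by (simp add: Basis2 inner_axis axis_eq_axis)
  finally show "emeasure (density (distr lborel borel (plane_map L)) (\<lambda>_. ennreal (L\<^sup>2))) (box l u)
      = ennreal (\<Prod>b\<in>Basis. (u - l) \<bullet> b)" .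
qed simp

lemma nn_integral_plane_map:
  assumes L: "L > 0" and [measurable]: "f \<in> borel_measurable borel"
  shows "(\<integral>\<^sup>+x. f x \<partial>lborel) = ennreal (L\<^sup>2) * (\<integral>\<^sup>+p. f (plane_map L p) \<partial>lborel)"
  by (subst lborel_plane_map[OF L]) (simp_all add: nn_integral_density nn_integral_distr nn_integral_cmult)

text \<open>
  The characterisation of simple connectivity by unbounded complementary components is a theorem
  about subsets of \<open>\<complex>\<close>; it is carried over by a linear homeomorphism.
\<close>

lemma complement_component_plane_map:
  assumes \<Omega>: "open \<Omega>" "simply_connected \<Omega>" and L: "L > 0" and y: "plane_map L y \<notin> \<Omega>"
  shows "\<exists>E. connected E \<and> \<not> bounded E \<and> y \<in> E \<and> plane_map L ` E \<inter> \<Omega> = {}"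
proof -
  define f :: "complex \<Rightarrow> real ^ 2" where "f z = plane_map L (Re z, Im z)" for z
  define g :: "real ^ 2 \<Rightarrow> complex" where "g v = Complex (v $ 1 / L) (v $ 2 / L)" for v
  define c where "c = Complex (fst y) (snd y)"
  have fg: "f (g v) = v" "g (f z) = z" for v z
    using L plane_map_surj[of L v] by (simp_all add: f_def g_def)
  have contf: "continuous_on A f" for A
    unfolding f_def by (intro continuous_on_compose2[OF continuous_plane_map[of UNIV]] continuous_intros) auto
  have contg: "continuous_on A g" for A
    unfolding g_def Complex_eq by (intro continuous_intros) (use L in auto)
  have "\<Omega> homeomorphic (f -` \<Omega>)"
    unfolding homeomorphic_def
    by (intro exI[of _ g] exI[of _ f] homeomorphismI contf contg) (auto simp: fg)
  then have "simply_connected (f -` \<Omega>)"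
    using \<Omega> homeomorphic_simply_connected_eq by blast
  moreover have "open (f -` \<Omega>)"
    using \<Omega>(1) contf by (simp add: open_vimage)
  ultimately have unb: "\<not> bounded C" if "C \<in> components (- (f -` \<Omega>))" for C
    using that simply_connected_eq_unbounded_complement_components by blast
  have "c \<in> - (f -` \<Omega>)"
    using y by (simp add: c_def f_def)
  then obtain C where C: "C \<in> components (- (f -` \<Omega>))" "c \<in> C"
    by (metis UnionE Union_components)
  define E where "E = (\<lambda>z. (Re z, Im z)) ` C"
  have "C = (\<lambda>p. Complex (fst p) (snd p)) ` E"
    unfolding E_def by (simp add: image_image)
  moreover have "bounded ((\<lambda>p. Complex (fst p) (snd p)) ` E)" if bE: "bounded E"
  proof -
    obtain B where "\<And>p. p \<in> E \<Longrightarrow> norm p \<le> B" using bE bounded_iff by blast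
    then show ?thesis
      unfolding bounded_iff by (intro exI[of _ B]) (auto simp: cmod_def norm_prod_def)
  qed
  ultimately have "\<not> bounded E" using unb[OF C(1)] by metis
  moreover have "connected E"
    unfolding E_def using in_components_connected[OF C(1)]
    by (intro connected_continuous_image continuous_intros)
  moreover have "y \<in> E"
    using C(2) by (force simp: E_def c_def)
  moreover have "plane_map L ` E \<inter> \<Omega> = {}"
    using in_components_subset[OF C(1)] by (auto simp: E_def f_def)
  ultimately show ?thesis by blast
qed

section \<open>The inequality for continuous functions\<close>

lemma sigma_finite_lebesgue: "sigma_finite_measure (lebesgue :: 'a::euclidean_space measure)"
proof
  obtain A where "countable A" "A \<subseteq> sets (lborel :: 'a measure)" "\<Union>A = space (lborel :: 'a measure)"
    "\<forall>a\<in>A. emeasure (lborel :: 'a measure) a \<noteq> \<infinity>"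
    using lborel.sigma_finite_countable by blast
  then show "\<exists>A. countable A \<and> A \<subseteq> sets (lebesgue :: 'a measure) \<and> \<Union>A = space (lebesgue :: 'a measure) \<and>
      (\<forall>a\<in>A. emeasure (lebesgue :: 'a measure) a \<noteq> \<infinity>)"
    by (intro exI[of _ A]) auto
qed

lemma measurable_gagliardo_integrand:
  fixes u :: "'a::euclidean_space \<Rightarrow> real"
  assumes u: "u \<in> borel_measurable lebesgue"
  shows "(\<lambda>(x, y). ennreal (\<bar>u x - u y\<bar>\<^sup>2 / norm (x - y) powr e)) \<in> borel_measurable (lebesgue \<Otimes>\<^sub>M lebesgue)"
proof -
  have id: "(\<lambda>x. x) \<in> borel_measurable (lebesgue :: 'a measure)"
    by (intro measurable_completion) simp
  have [measurable]:
    "(\<lambda>z. u (fst z)) \<in> borel_measurable ((lebesgue :: 'a measure) \<Otimes>\<^sub>M (lebesgue :: 'a measure))"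
    "(\<lambda>z. u (snd z)) \<in> borel_measurable ((lebesgue :: 'a measure) \<Otimes>\<^sub>M (lebesgue :: 'a measure))"
    "fst \<in> borel_measurable ((lebesgue :: 'a measure) \<Otimes>\<^sub>M (lebesgue :: 'a measure))"
    "snd \<in> borel_measurable ((lebesgue :: 'a measure) \<Otimes>\<^sub>M (lebesgue :: 'a measure))"
    by (rule measurable_compose[OF measurable_fst u] measurable_compose[OF measurable_snd u]
      measurable_compose[OF measurable_fst id] measurable_compose[OF measurable_snd id])+
  show ?thesis unfolding split_beta by measurable
qed

lemma gagliardo_sq_eq_lborel:
  fixes u :: "'a::euclidean_space \<Rightarrow> real"
  assumes u: "u \<in> borel_measurable borel"
  shows "gagliardo_sq s u =
    (\<integral>\<^sup>+x. (\<integral>\<^sup>+y. ennreal ((u x - u y)\<^sup>2 / norm (x - y) powr (real DIM('a) + 2 * s)) \<partial>lborel) \<partial>lborel)"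
proof -
  have u': "u \<in> borel_measurable lebesgue"
    using u by (simp add: measurable_completion)
  have "gagliardo_sq s u = (\<integral>\<^sup>+x. (\<integral>\<^sup>+y. ennreal (\<bar>u x - u y\<bar>\<^sup>2 / norm (x - y) powr (real DIM('a) + 2 * s)) \<partial>lebesgue) \<partial>lebesgue)"
    unfolding gagliardo_sq_def
    using sigma_finite_measure.nn_integral_fst[OF sigma_finite_lebesgue measurable_gagliardo_integrand[OF u']]
    by simp
  then show ?thesis by (simp add: nn_integral_completion)
qed

lemma L2_sq_UNIV_eq: "L2_sq UNIV u = (\<integral>\<^sup>+x. ennreal ((u x)\<^sup>2) \<partial>lborel)"
  by (simp add: L2_sq_def nn_integral_completion)

lemma ball_leaves_set:
  assumes r: "inradius \<Omega> = ereal r" and "r < \<rho>" "0 < \<rho>"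
  shows "\<exists>y\<in>ball x \<rho>. y \<notin> \<Omega>"
proof (rule ccontr)
  assume "\<not> ?thesis"
  then have sub: "ball x \<rho> \<subseteq> \<Omega>" by auto
  moreover have "x \<in> \<Omega>" using sub \<open>0 < \<rho>\<close> by auto
  ultimately have "ereal \<rho> \<le> inradius \<Omega>"
    unfolding inradius_def using \<open>0 < \<rho>\<close> by (intro SUP_upper) auto
  then show False using r \<open>r < \<rho>\<close> by simp
qed

lemma inradius_pos:
  assumes "open \<Omega>" "\<Omega> \<noteq> {}" and r: "inradius \<Omega> = ereal r"
  shows "0 < r"
proof -
  obtain x e where "x \<in> \<Omega>" "0 < e" "ball x e \<subseteq> \<Omega>"
    using assms by (metis all_not_in_conv openE)
  then have "ereal e \<le> inradius \<Omega>"
    unfolding inradius_def by (intro SUP_upper) auto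
  then show ?thesis using \<open>0 < e\<close> r by simp
qed

text \<open>
  A unit cell corresponds to a square of side \<open>8 r\<close>, and a ball of radius \<open>2 r\<close> round its centre
  is not contained in \<open>\<Omega>\<close>. After rescaling this gives a point of the complement within \<open>1/4\<close> of the
  centre of the cell.
\<close>

lemma exists_zeros_in_unit_cell:
  fixes u :: "real ^ 2 \<Rightarrow> real"
  assumes \<Omega>: "open \<Omega>" "simply_connected \<Omega>" "inradius \<Omega> = ereal r" and r: "0 < r" and L: "L = 8 * r"
    and u: "\<And>v. v \<notin> \<Omega> \<Longrightarrow> u v = 0"
  shows "\<exists>S\<in>sets borel. S \<subseteq> dyadic_cell 0 x \<and> emeasure lborel S \<ge> ennreal (1 / 20) \<and>
      (\<forall>a\<in>S. \<exists>z\<in>dyadic_cell 0 x. u (plane_map L z) = 0 \<and> (fst z = fst a \<or> snd z = snd a))"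
proof -
  have L0: "L > 0" using r L by simp
  define c where "c = (real_of_int \<lfloor>fst x\<rfloor> + 1/2, real_of_int \<lfloor>snd x\<rfloor> + 1/2)"
  obtain v where v: "v \<in> ball (plane_map L c) (2 * r)" "v \<notin> \<Omega>"
    using ball_leaves_set[OF \<Omega>(3), of "2 * r" "plane_map L c"] r by (auto simp del: mem_ball)
  define y where "y = (v $ 1 / L, v $ 2 / L)"
  have y: "plane_map L y = v"
    unfolding y_def using L0 by (intro plane_map_surj) simp
  have "L * norm (y - c) \<le> 2 * r"
    using v(1) norm_plane_map_diff[OF L0, of y c] by (simp add: y dist_norm norm_minus_commute)
  then have "norm (y - c) \<le> 1/4"
    using r by (simp add: L)
  then have near: "\<bar>fst y - fst c\<bar> \<le> 1/4" "\<bar>snd y - snd c\<bar> \<le> 1/4"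
  proof -
    have "\<bar>fst p\<bar> \<le> norm p" "\<bar>snd p\<bar> \<le> norm p" for p :: "real \<times> real"
      using norm_fst_le[of "fst p" "snd p"] norm_snd_le[of "snd p" "fst p"] by simp_all
    from this[of "y - c"] \<open>norm (y - c) \<le> 1/4\<close>
    show "\<bar>fst y - fst c\<bar> \<le> 1/4" "\<bar>snd y - snd c\<bar> \<le> 1/4" by simp_all
  qed
  obtain E where E: "connected E" "\<not> bounded E" "y \<in> E" "plane_map L ` E \<inter> \<Omega> = {}"
    using complement_component_plane_map[OF \<Omega>(1,2) L0, of y] v y by auto
  define Z where "Z = - (plane_map L -` \<Omega>)"
  have "open (plane_map L -` \<Omega>)"
    using \<Omega>(1) continuous_plane_map[of UNIV L] by (simp add: open_vimage)
  then have "closed Z" unfolding Z_def by (rule closed_Compl)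
  moreover have "E \<subseteq> Z" using E(4) by (auto simp: Z_def)
  ultimately obtain S where "S \<in> sets borel" "S \<subseteq> dyadic_cell 0 x" "emeasure lborel S \<ge> ennreal (1 / 20)"
    "\<forall>a\<in>S. \<exists>z\<in>dyadic_cell 0 x. z \<in> Z \<and> (fst z = fst a \<or> snd z = snd a)"
    using zeros_in_unit_cell[OF _ _ E(1-3), of Z x] near by (auto simp: c_def)
  moreover have "u (plane_map L z) = 0" if "z \<in> Z" for z
    using that u by (simp add: Z_def)
  ultimately show ?thesis by blast
qed

lemma fractional_makai_hayman_continuous:
  fixes u :: "real ^ 2 \<Rightarrow> real"
  assumes s: "1/2 < s" "s < 1"
    and \<Omega>: "open \<Omega>" "simply_connected \<Omega>" "inradius \<Omega> = ereal r" and r: "0 < r"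
    and cont: "continuous_on UNIV u" and u: "\<And>v. v \<notin> \<Omega> \<Longrightarrow> u v = 0"
  shows "L2_sq UNIV u \<le> ennreal (4000000 * (1 - s) / (s - 1/2) * (8 * r) powr (2 * s)) * gagliardo_sq s u"
proof -
  define L where "L = 8 * r"
  define U where "U p = u (plane_map L p)" for p
  define \<kappa> where "\<kappa> = 4000000 * (1 - s) / (s - 1/2)"
  define I where "I = (\<integral>\<^sup>+p. (\<integral>\<^sup>+q. ennreal ((U p - U q)\<^sup>2 / norm (p - q) powr (2 + 2 * s)) \<partial>lborel) \<partial>lborel)"
  have L: "L > 0" using r by (simp add: L_def)
  have \<kappa>: "0 \<le> \<kappa>" using s by (simp add: \<kappa>_def)
  have [measurable]: "u \<in> borel_measurable borel"
    using cont by (rule borel_measurable_continuous_onI)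
  have [measurable]: "U \<in> borel_measurable borel"
    unfolding U_def by measurable
  have contU: "continuous_on UNIV U"
    unfolding U_def by (intro continuous_on_compose2[OF cont continuous_plane_map]) auto
  have "L2_sq UNIV u = ennreal (L\<^sup>2) * (\<integral>\<^sup>+p. ennreal ((U p)\<^sup>2) \<partial>lborel)"
    unfolding L2_sq_UNIV_eq U_def using L by (intro nn_integral_plane_map) measurable
  also have "\<dots> \<le> ennreal (L\<^sup>2) * (ennreal \<kappa> * I)"
    unfolding I_def \<kappa>_def
    using exists_zeros_in_unit_cell[OF \<Omega> r L_def u]
    by (intro mult_left_mono fractional_poincare_unit_scale contU s) (simp_all add: U_def)
  finally have bound: "L2_sq UNIV u \<le> ennreal (L\<^sup>2) * (ennreal \<kappa> * I)" .
  have "gagliardo_sq s u = (\<integral>\<^sup>+x. (\<integral>\<^sup>+y. ennreal ((u x - u y)\<^sup>2 / norm (x - y) powr (2 + 2 * s)) \<partial>lborel) \<partial>lborel)"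
    by (subst gagliardo_sq_eq_lborel) simp_all
  also have "\<dots> = ennreal (L\<^sup>2) * (\<integral>\<^sup>+p. (\<integral>\<^sup>+y. ennreal ((U p - u y)\<^sup>2 / norm (plane_map L p - y) powr (2 + 2 * s)) \<partial>lborel) \<partial>lborel)"
    unfolding U_def using L by (intro nn_integral_plane_map) measurable
  also have "\<dots> = ennreal (L\<^sup>2) * (\<integral>\<^sup>+p. ennreal (L\<^sup>2) * (\<integral>\<^sup>+q. ennreal ((U p - U q)\<^sup>2 / norm (plane_map L p - plane_map L q) powr (2 + 2 * s)) \<partial>lborel) \<partial>lborel)"
    unfolding U_def using L by (intro arg_cong2[where f="(*)"] refl nn_integral_cong nn_integral_plane_map) measurable
  also have "\<dots> = ennreal (L\<^sup>2) * (\<integral>\<^sup>+p. ennreal (L\<^sup>2) * (\<integral>\<^sup>+q. ennreal (1 / L powr (2 + 2 * s)) *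
      ennreal ((U p - U q)\<^sup>2 / norm (p - q) powr (2 + 2 * s)) \<partial>lborel) \<partial>lborel)"
    using L by (simp add: norm_plane_map_diff powr_mult ennreal_mult[symmetric])
  also have "\<dots> = ennreal (L\<^sup>2) * (ennreal (L\<^sup>2) * (ennreal (1 / L powr (2 + 2 * s)) * I))"
    unfolding I_def by (simp add: nn_integral_cmult)
  finally have G: "gagliardo_sq s u = ennreal (L\<^sup>2) * (ennreal (L\<^sup>2) * (ennreal (1 / L powr (2 + 2 * s)) * I))" .
  have "ennreal (\<kappa> * L powr (2 * s)) * gagliardo_sq s u
      = ennreal (\<kappa> * L powr (2 * s) * (L\<^sup>2 * (L\<^sup>2 * (1 / L powr (2 + 2 * s))))) * I"
    unfolding G using \<kappa> L by (simp only: ennreal_mult mult.assoc zero_le_power2 powr_ge_zero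
        mult_nonneg_nonneg zero_le_divide_1_iff)
  also have "\<kappa> * L powr (2 * s) * (L\<^sup>2 * (L\<^sup>2 * (1 / L powr (2 + 2 * s)))) = L\<^sup>2 * \<kappa>"
    using L by (simp add: powr_add power2_eq_square)
  also have "ennreal (L\<^sup>2 * \<kappa>) * I = ennreal (L\<^sup>2) * (ennreal \<kappa> * I)"
    using \<kappa> by (simp add: ennreal_mult mult.assoc)
  finally show ?thesis
    using bound by (simp add: \<kappa>_def L_def)
qed

section \<open>Test functions have finite energy\<close>

lemma test_function_continuous:
  assumes "\<phi> \<in> test_functions \<Omega>"
  shows "continuous_on UNIV \<phi>"
  using assms unfolding test_functions_def by (metis (mono_tags, lifting) C_k.simps(1) mem_Collect_eq)

lemma test_function_vanishes:
  assumes "\<phi> \<in> test_functions \<Omega>" "v \<notin> \<Omega>"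
  shows "\<phi> v = 0"
  using assms closure_subset[of "{x. \<phi> x \<noteq> 0}"] unfolding test_functions_def by blast

text \<open>
  The derivative is bounded on a ball that contains the 1-neighbourhood of the support. Two points
  at distance at most 1 either both lie in this ball or are both zeros of \<open>\<phi>\<close>; for points further apart the
  Lipschitz bound follows from boundedness.
\<close>

lemma test_function_bounds:
  fixes \<phi> :: "'a::euclidean_space \<Rightarrow> real"
  assumes \<phi>: "\<phi> \<in> test_functions \<Omega>"
  shows "\<exists>M R. 0 < R \<and> 0 \<le> M \<and> (\<forall>x. \<phi> x \<noteq> 0 \<longrightarrow> norm x \<le> R) \<and> (\<forall>x. \<bar>\<phi> x\<bar> \<le> M) \<and>
    (\<forall>x y. \<bar>\<phi> x - \<phi> y\<bar> \<le> M * norm (x - y))"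
proof -
  let ?D = "\<lambda>x. frechet_derivative \<phi> (at x)"
  have "C_k (Suc 0) \<phi>" and cpt: "compact (closure {x. \<phi> x \<noteq> 0})"
    using \<phi> unfolding test_functions_def by blast+
  then have diff: "\<And>x. \<phi> differentiable (at x)" and contD: "\<And>v. continuous_on UNIV (\<lambda>x. ?D x v)"
    by (auto simp: differentiable_on_def)
  have D: "(\<phi> has_derivative ?D x) (at x)" for x
    using diff frechet_derivative_works by blast
  obtain R where R: "0 < R" "\<And>x. \<phi> x \<noteq> 0 \<Longrightarrow> norm x \<le> R"
    using compact_imp_bounded[OF cpt] closure_subset[of "{x. \<phi> x \<noteq> 0}"]
    by (metis (mono_tags, lifting) bounded_pos mem_Collect_eq subsetD)
  have bdd: "\<exists>B. \<forall>x\<in>cball 0 (R + 1). \<bar>f x\<bar> \<le> B" if "continuous_on UNIV f" for f :: "'a \<Rightarrow> real"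
  proof -
    have "compact (f ` cball 0 (R + 1))"
      using that by (intro compact_continuous_image) (auto intro: continuous_on_subset)
    then have "bounded (f ` cball 0 (R + 1))"
      by (rule compact_imp_bounded)
    then show ?thesis
      by (simp add: bounded_iff)
  qed
  obtain B0 where B0: "\<And>x. x \<in> cball 0 (R + 1) \<Longrightarrow> \<bar>\<phi> x\<bar> \<le> B0"
    using bdd[OF test_function_continuous[OF \<phi>]] by blast
  obtain B where B: "\<And>v x. x \<in> cball 0 (R + 1) \<Longrightarrow> \<bar>?D x v\<bar> \<le> B v"
    using bdd[OF contD] by metis
  define K where "K = (\<Sum>b\<in>Basis. B b)"
  have Bpos: "0 \<le> B v" for v
    using B[of 0 v] R(1) by auto
  have lip: "\<bar>\<phi> x - \<phi> y\<bar> \<le> K * norm (x - y)" if "x \<in> cball 0 (R + 1)" "y \<in> cball 0 (R + 1)" for x y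
  proof -
    have "norm (\<phi> x - \<phi> y) \<le> K * norm (x - y)"
    proof (rule differentiable_bound[OF convex_cball])
      show "(\<phi> has_derivative ?D z) (at z within cball 0 (R + 1))" for z
        using D by (rule has_derivative_at_withinI)
      fix z :: 'a assume z: "z \<in> cball 0 (R + 1)"
      show "onorm (?D z) \<le> K"
      proof (rule onorm_le)
        fix v
        have lin: "linear (?D z)" using D has_derivative_linear by blast
        have "?D z v = ?D z (\<Sum>b\<in>Basis. (v \<bullet> b) *\<^sub>R b)"
          by (simp add: euclidean_representation)
        also have "\<dots> = (\<Sum>b\<in>Basis. (v \<bullet> b) *\<^sub>R ?D z b)"
          using lin by (simp add: linear_sum linear_cmul)
        finally have "norm (?D z v) \<le> (\<Sum>b\<in>Basis. norm ((v \<bullet> b) *\<^sub>R ?D z b))"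
          by (metis norm_sum)
        also have "\<dots> \<le> (\<Sum>b\<in>Basis. norm v * B b)"
          using B[OF z] by (intro sum_mono) (auto simp: abs_mult intro!: mult_mono Basis_le_norm)
        also have "\<dots> = K * norm v" by (simp add: K_def sum_distrib_left mult.commute)
        finally show "norm (?D z v) \<le> K * norm v" .
      qed
    qed (use that in auto)
    then show ?thesis by simp
  qed
  define M where "M = max K (2 * \<bar>B0\<bar>)"
  have sup: "\<bar>\<phi> x\<bar> \<le> \<bar>B0\<bar>" for x
  proof (cases "\<phi> x = 0")
    case False
    then show ?thesis using B0[of x] R by fastforce
  qed simp
  have half: "\<bar>\<phi> x - \<phi> y\<bar> \<le> M * norm (x - y)" if "\<phi> x \<noteq> 0" for x y
  proof (cases "norm (x - y) \<le> 1")
    case True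
    have x: "norm x \<le> R" using R that by blast
    have "norm y \<le> norm x + norm (x - y)"
      using norm_triangle_sub[of y x] by (simp add: norm_minus_commute)
    then have "\<bar>\<phi> x - \<phi> y\<bar> \<le> K * norm (x - y)"
      using True x by (intro lip) auto
    also have "\<dots> \<le> M * norm (x - y)" by (intro mult_right_mono) (auto simp: M_def)
    finally show ?thesis .
  next
    case False
    have "\<bar>\<phi> x - \<phi> y\<bar> \<le> M * 1" using sup[of x] sup[of y] by (simp add: M_def)
    also have "\<dots> \<le> M * norm (x - y)" using False by (intro mult_left_mono) (auto simp: M_def)
    finally show ?thesis .
  qed
  have "\<bar>\<phi> x - \<phi> y\<bar> \<le> M * norm (x - y)" for x y
    using half[of x y] half[of y x] by (cases "\<phi> x = 0"; cases "\<phi> y = 0") (auto simp: norm_minus_commute M_def)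
  moreover have "\<bar>\<phi> x\<bar> \<le> M" for x using sup[of x] by (simp add: M_def)
  moreover have "0 \<le> M" by (simp add: M_def)
  ultimately show ?thesis using R by blast
qed

text \<open>
  Dyadic annuli: near 0 the kernel is of order \<open>\<bar>h\<bar> powr (2 - n - 2 s)\<close> and \<open>s < 1\<close> makes the series
  of annuli converge, at infinity it is of order \<open>\<bar>h\<bar> powr (- n - 2 s)\<close> and \<open>s > 0\<close> is what is needed.
\<close>

lemma nn_integral_fractional_kernel_finite:
  fixes s :: real
  assumes s: "0 < s" "s < 1"
  shows "(\<integral>\<^sup>+(h::'a::euclidean_space). ennreal (min 1 ((norm h)\<^sup>2) / norm h powr (real DIM('a) + 2 * s)) \<partial>lborel) < \<infinity>"
proof -
  let ?n = "DIM('a)" and ?e = "real DIM('a) + 2 * s"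
  let ?V = "unit_ball_vol (real ?n)"
  define \<alpha> where "\<alpha> k = 2 powr ?e * (2 powr (?n + 2 * s - 2)) ^ k" for k :: nat
  define \<beta> where "\<beta> k = (2 powr (- ?e)) ^ k" for k :: nat
  have pw: "(2 powr a) ^ k = 2 powr (a * real k)" for a :: real and k :: nat
    by (simp add: powr_realpow[symmetric] powr_powr)
  have term_le: "f k \<le> (\<Sum>k. f k)" for f :: "nat \<Rightarrow> ennreal" and k
    using sum_le_suminf[of f "{k}"] by simp
  have pointwise: "ennreal (min 1 ((norm h)\<^sup>2) / norm h powr ?e) \<le>
    (\<Sum>k. ennreal (\<alpha> k) * indicator (cball 0 (1 / 2 ^ k)) h) + (\<Sum>k. ennreal (\<beta> k) * indicator (cball 0 (2 * 2 ^ k)) h)"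
    (is "?w \<le> ?A + ?B") for h :: 'a
  proof (cases "h = 0")
    case False
    then have h: "norm h > 0" by simp
    show ?thesis
    proof (cases "norm h \<le> 1")
      case True
      define k where "k = nat \<lfloor>log 2 (1 / norm h)\<rfloor>"
      have "0 \<le> log 2 (1 / norm h)" using h True by simp
      then have "real k \<le> log 2 (1 / norm h)" "log 2 (1 / norm h) < real k + 1"
        unfolding k_def by linarith+
      then have "2 powr real k \<le> 1 / norm h" "1 / norm h < 2 powr (real k + 1)"
        using h by (simp_all add: le_log_iff log_less_iff)
      then have k: "norm h \<le> 1 / 2 ^ k" "2 powr - (real k + 1) \<le> norm h" "norm h \<le> 2 powr - real k"
      proof -
        have pos: "0 < (2::real) powr real k" "0 < (2::real) powr (real k + 1)" by simp_all
        show "norm h \<le> 2 powr - real k" "2 powr - (real k + 1) \<le> norm h"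
          unfolding powr_minus_divide using h pos \<open>2 powr real k \<le> 1 / norm h\<close> \<open>1 / norm h < 2 powr (real k + 1)\<close>
          by (simp_all only: pos_le_divide_eq pos_divide_le_eq pos_divide_less_eq mult.commute less_imp_le)
        then show "norm h \<le> 1 / 2 ^ k"
          by (simp add: powr_minus_divide powr_realpow)
      qed
      have "min 1 ((norm h)\<^sup>2) / norm h powr ?e \<le> (2 powr - real k)\<^sup>2 / (2 powr - (real k + 1)) powr ?e"
        using h k s by (intro frac_le) (auto intro!: powr_mono2 min.coboundedI2 power_mono)
      also have "\<dots> = \<alpha> k"
        unfolding \<alpha>_def pw powr_powr by (simp add: power2_eq_square powr_diff[symmetric] powr_add[symmetric] algebra_simps)
      finally have "?w \<le> ennreal (\<alpha> k) * indicator (cball 0 (1 / 2 ^ k)) h"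
        using k(1) by (simp add: ennreal_leI)
      also have "\<dots> \<le> ?A"
        by (rule term_le)
      finally show ?thesis by (simp add: add_increasing2)
    next
      case False
      define k where "k = nat \<lfloor>log 2 (norm h)\<rfloor>"
      have "0 \<le> log 2 (norm h)" using h False by simp
      then have "real k \<le> log 2 (norm h)" "log 2 (norm h) < real k + 1"
        unfolding k_def by linarith+
      then have "2 powr real k \<le> norm h" "norm h < 2 powr (real k + 1)"
        using h by (simp_all add: le_log_iff log_less_iff)
      then have k: "norm h \<le> 2 * 2 ^ k" "2 powr real k \<le> norm h"
        using h by (auto simp: powr_realpow powr_add)
      have "min 1 ((norm h)\<^sup>2) / norm h powr ?e \<le> 1 / (2 powr real k) powr ?e"
        using h k s by (intro frac_le) (auto intro!: powr_mono2)
      also have "\<dots> = \<beta> k"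
        unfolding \<beta>_def pw powr_powr by (simp add: powr_minus_divide[symmetric] algebra_simps)
      finally have "?w \<le> ennreal (\<beta> k) * indicator (cball 0 (2 * 2 ^ k)) h"
        using k(1) by (simp add: ennreal_leI)
      also have "\<dots> \<le> ?B"
        by (rule term_le)
      finally show ?thesis by (simp add: add_increasing)
    qed
  qed simp
  have A: "(\<integral>\<^sup>+h. (\<Sum>k. ennreal (\<alpha> k) * indicator (cball (0::'a) (1 / 2 ^ k)) h) \<partial>lborel) < \<infinity>"
  proof -
    have "ennreal (\<alpha> k) * emeasure lborel (cball (0::'a) (1 / 2 ^ k)) = ennreal (?V * 2 powr ?e * (2 powr (2 * s - 2)) ^ k)" for k
    proof -
      have "(2 powr (?n + 2 * s - 2)) ^ k * (1 / 2 ^ k) ^ ?n = (2 powr (2 * s - 2)) ^ k"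
      proof -
        have "(1 / 2 ^ k) ^ ?n = (2::real) powr (- (real k * real ?n))"
          by (simp add: powr_minus_divide powr_realpow[symmetric] powr_powr power_one_over)
        then show ?thesis
          unfolding pw by (simp add: powr_add[symmetric] algebra_simps)
      qed
      moreover have "\<alpha> k * (?V * (1 / 2 ^ k) ^ ?n)
          = ?V * 2 powr ?e * ((2 powr (?n + 2 * s - 2)) ^ k * (1 / 2 ^ k) ^ ?n)"
        unfolding \<alpha>_def by (simp only: mult.assoc mult.commute mult.left_commute)
      ultimately have "\<alpha> k * (?V * (1 / 2 ^ k) ^ ?n) = ?V * 2 powr ?e * (2 powr (2 * s - 2)) ^ k"
        by (simp only:)
      then show ?thesis
        by (subst emeasure_cball) (simp_all add: ennreal_mult'[symmetric] \<alpha>_def)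
    qed
    moreover have "summable (\<lambda>k. ?V * 2 powr ?e * (2 powr (2 * s - 2)) ^ k)"
      using s powr_less_mono[of "2 * s - 2" 0 "2::real"] by (intro summable_mult summable_geometric) simp
    ultimately have "(\<Sum>k. ennreal (\<alpha> k) * emeasure lborel (cball (0::'a) (1 / 2 ^ k))) \<noteq> top"
      by (simp add: suminf_ennreal2 unit_ball_vol_nonneg del: ennreal_power)
    then show ?thesis
      by (simp add: nn_integral_suminf nn_integral_cmult_indicator less_top)
  qed
  have B: "(\<integral>\<^sup>+h. (\<Sum>k. ennreal (\<beta> k) * indicator (cball (0::'a) (2 * 2 ^ k)) h) \<partial>lborel) < \<infinity>"
  proof -
    have "ennreal (\<beta> k) * emeasure lborel (cball (0::'a) (2 * 2 ^ k)) = ennreal (?V * 2 ^ ?n * (2 powr (- 2 * s)) ^ k)" for k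
    proof -
      have "(2 powr (- ?e)) ^ k * (2 ^ k) ^ ?n = (2 powr (- 2 * s)) ^ k"
      proof -
        have "(2 ^ k) ^ ?n = (2::real) powr (real k * real ?n)"
          by (simp add: powr_realpow[symmetric] powr_powr)
        then show ?thesis
          unfolding pw by (simp add: powr_add[symmetric] algebra_simps)
      qed
      moreover have "\<beta> k * (?V * (2 * 2 ^ k) ^ ?n)
          = ?V * 2 ^ ?n * ((2 powr (- ?e)) ^ k * (2 ^ k) ^ ?n)"
        unfolding \<beta>_def power_mult_distrib[of 2 "2 ^ k"] by (simp only: mult.assoc mult.commute mult.left_commute)
      ultimately have "\<beta> k * (?V * (2 * 2 ^ k) ^ ?n) = ?V * 2 ^ ?n * (2 powr (- 2 * s)) ^ k"
        by (simp only:)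
      then show ?thesis
        by (subst emeasure_cball) (simp_all add: ennreal_mult'[symmetric] \<beta>_def)
    qed
    moreover have "summable (\<lambda>k. ?V * 2 ^ ?n * (2 powr (- 2 * s)) ^ k)"
      using s powr_less_mono[of "- 2 * s" 0 "2::real"] by (intro summable_mult summable_geometric) simp
    ultimately have "(\<Sum>k. ennreal (\<beta> k) * emeasure lborel (cball (0::'a) (2 * 2 ^ k))) \<noteq> top"
      by (simp add: suminf_ennreal2 unit_ball_vol_nonneg del: ennreal_power)
    then show ?thesis
      by (simp add: nn_integral_suminf nn_integral_cmult_indicator less_top)
  qed
  have "(\<integral>\<^sup>+(h::'a). ennreal (min 1 ((norm h)\<^sup>2) / norm h powr ?e) \<partial>lborel) \<le>
    (\<integral>\<^sup>+h. (\<Sum>k. ennreal (\<alpha> k) * indicator (cball (0::'a) (1 / 2 ^ k)) h)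
       + (\<Sum>k. ennreal (\<beta> k) * indicator (cball 0 (2 * 2 ^ k)) h) \<partial>lborel)"
    by (intro nn_integral_mono pointwise)
  also have "\<dots> = (\<integral>\<^sup>+h. (\<Sum>k. ennreal (\<alpha> k) * indicator (cball (0::'a) (1 / 2 ^ k)) h) \<partial>lborel)
       + (\<integral>\<^sup>+h. (\<Sum>k. ennreal (\<beta> k) * indicator (cball (0::'a) (2 * 2 ^ k)) h) \<partial>lborel)"
    by (intro nn_integral_add) measurable
  also have "\<dots> < \<infinity>" using A B by simp
  finally show ?thesis .
qed

lemma test_function_L2_finite:
  fixes \<phi> :: "'a::euclidean_space \<Rightarrow> real"
  assumes \<phi>: "\<phi> \<in> test_functions \<Omega>"
  shows "L2_sq UNIV \<phi> < \<infinity>"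
proof -
  obtain M R where M: "\<And>x. \<phi> x \<noteq> 0 \<Longrightarrow> norm x \<le> R" "\<And>x. \<bar>\<phi> x\<bar> \<le> M" "0 < R" "0 \<le> M"
    using test_function_bounds[OF \<phi>] by blast
  have "L2_sq UNIV \<phi> \<le> (\<integral>\<^sup>+x. ennreal (M\<^sup>2) * indicator (cball (0::'a) R) x \<partial>lborel)"
    unfolding L2_sq_UNIV_eq
  proof (intro nn_integral_mono)
    fix x
    have "(\<phi> x)\<^sup>2 \<le> M\<^sup>2"
      using M(2)[of x] M(4) abs_le_square_iff[of "\<phi> x" M] by simp
    then show "ennreal ((\<phi> x)\<^sup>2) \<le> ennreal (M\<^sup>2) * indicator (cball 0 R) x"
      using M(1)[of x] by (cases "\<phi> x = 0") (simp_all add: ennreal_leI)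
  qed
  also have "\<dots> < \<infinity>"
    using M by (simp add: nn_integral_cmult_indicator emeasure_cball ennreal_mult_less_top)
  finally show ?thesis .
qed

text \<open>
  An increment by \<open>h\<close> is bounded by a multiple of \<open>min 1 \<bar>h\<bar>\<close> and vanishes at \<open>x\<close> unless \<open>x\<close> or \<open>x + h\<close> lies
  in the support.
\<close>

lemma test_function_gagliardo_finite:
  fixes \<phi> :: "'a::euclidean_space \<Rightarrow> real"
  assumes \<phi>: "\<phi> \<in> test_functions \<Omega>" and s: "0 < s" "s < 1"
  shows "gagliardo_sq s \<phi> < \<infinity>"
proof -
  let ?e = "real DIM('a) + 2 * s"
  obtain M R where M: "\<And>x. \<phi> x \<noteq> 0 \<Longrightarrow> norm x \<le> R" "\<And>x. \<bar>\<phi> x\<bar> \<le> M" "0 < R" "0 \<le> M"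
      "\<And>x y. \<bar>\<phi> x - \<phi> y\<bar> \<le> M * norm (x - y)"
    using test_function_bounds[OF \<phi>] by blast
  have [measurable]: "\<phi> \<in> borel_measurable borel"
    using test_function_continuous[OF \<phi>] by (rule borel_measurable_continuous_onI)
  have shift: "shift_energy \<phi> h \<le> ennreal (4 * M\<^sup>2 * min 1 ((norm h)\<^sup>2)) * (2 * emeasure lborel (cball (0::'a) R))" for h
  proof -
    have "shift_energy \<phi> h \<le> (\<integral>\<^sup>+x. ennreal (4 * M\<^sup>2 * min 1 ((norm h)\<^sup>2)) *
        (indicator (cball 0 R) (h + x) + indicator (cball 0 R) x) \<partial>lborel)"
      unfolding shift_energy_def
    proof (intro nn_integral_mono)
      fix x
      have "\<bar>\<phi> (x + h) - \<phi> x\<bar> \<le> 2 * M" using M(2)[of "x + h"] M(2)[of x] by linarith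
      then have "(\<phi> (x + h) - \<phi> x)\<^sup>2 \<le> (2 * M)\<^sup>2"
        using M(4) abs_le_square_iff[of "\<phi> (x + h) - \<phi> x" "2 * M"] by simp
      moreover have "(\<phi> (x + h) - \<phi> x)\<^sup>2 \<le> (2 * M * norm h)\<^sup>2"
      proof (rule abs_le_square_iff[THEN iffD1])
        have "M * norm h \<le> 2 * M * norm h" using M(4) by simp
        then show "\<bar>\<phi> (x + h) - \<phi> x\<bar> \<le> \<bar>2 * M * norm h\<bar>" using M(5)[of "x + h" x] by simp
      qed
      ultimately have "(\<phi> (x + h) - \<phi> x)\<^sup>2 \<le> 4 * M\<^sup>2 * min 1 ((norm h)\<^sup>2)"
        by (auto simp: min_def power_mult_distrib)
      then have "ennreal ((\<phi> (x + h) - \<phi> x)\<^sup>2) \<le> ennreal (4 * M\<^sup>2 * min 1 ((norm h)\<^sup>2)) * 1"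
        by (simp add: ennreal_leI)
      note bound = this
      have support: "1 \<le> indicator (cball 0 R) (h + x) + (indicator (cball 0 R) x :: ennreal)"
        if "\<phi> (x + h) \<noteq> \<phi> x"
        using that M(1)[of "x + h"] M(1)[of x] by (cases "\<phi> x = 0") (auto simp: indicator_def add.commute)
      show "ennreal ((\<phi> (x + h) - \<phi> x)\<^sup>2) \<le> ennreal (4 * M\<^sup>2 * min 1 ((norm h)\<^sup>2)) *
        (indicator (cball 0 R) (h + x) + indicator (cball 0 R) x)"
      proof (cases "\<phi> (x + h) = \<phi> x")
        case False
        show ?thesis
          by (rule order_trans[OF bound mult_left_mono[OF support[OF False]]]) simp
      qed simp
    qed
    also have "\<dots> = ennreal (4 * M\<^sup>2 * min 1 ((norm h)\<^sup>2)) *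
        (\<integral>\<^sup>+x. indicator (cball 0 R) (h + x) + indicator (cball 0 R) x \<partial>lborel)"
      by (rule nn_integral_cmult) measurable
    also have "(\<integral>\<^sup>+x. indicator (cball 0 R) (h + x) + indicator (cball 0 R) x \<partial>lborel)
      = (\<integral>\<^sup>+x. indicator (cball 0 R) (h + x) \<partial>lborel) + (\<integral>\<^sup>+x. indicator (cball (0::'a) R) x \<partial>lborel)"
      by (rule nn_integral_add) measurable
    also have "(\<integral>\<^sup>+x. indicator (cball 0 R) (h + x) \<partial>lborel) = (\<integral>\<^sup>+x. indicator (cball (0::'a) R) x \<partial>lborel)"
      by (rule nn_integral_lborel_translate) measurable
    finally show ?thesis by (simp flip: mult_2)
  qed
  have "gagliardo_sq s \<phi> = (\<integral>\<^sup>+(h::'a). shift_energy \<phi> h * ennreal (1 / norm h powr ?e) \<partial>lborel)"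
  proof -
    have "gagliardo_sq s \<phi> = (\<integral>\<^sup>+(h::'a). (\<integral>\<^sup>+x. ennreal ((\<phi> x - \<phi> (x + h))\<^sup>2 / norm (x - (x + h)) powr ?e) \<partial>lborel) \<partial>lborel)"
      unfolding gagliardo_sq_eq_lborel[OF \<open>\<phi> \<in> borel_measurable borel\<close>]
      by (rule nn_integral_shift_variables) simp
    then show ?thesis
      unfolding shift_energy_def
      by (simp add: nn_integral_multc[symmetric] ennreal_mult[symmetric] power2_commute)
  qed
  also have "\<dots> \<le> (\<integral>\<^sup>+(h::'a). (ennreal (4 * M\<^sup>2) * (2 * emeasure lborel (cball (0::'a) R))) *
      ennreal (min 1 ((norm h)\<^sup>2) / norm h powr ?e) \<partial>lborel)"
  proof (intro nn_integral_mono)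
    fix h :: 'a
    have "ennreal (4 * M\<^sup>2 * min 1 ((norm h)\<^sup>2)) * ennreal (1 / norm h powr ?e)
      = ennreal (4 * M\<^sup>2) * ennreal (min 1 ((norm h)\<^sup>2) / norm h powr ?e)"
      by (simp add: ennreal_mult[symmetric])
    then show "shift_energy \<phi> h * ennreal (1 / norm h powr ?e) \<le>
      (ennreal (4 * M\<^sup>2) * (2 * emeasure lborel (cball (0::'a) R))) * ennreal (min 1 ((norm h)\<^sup>2) / norm h powr ?e)"
      using mult_right_mono[OF shift[of h], of "ennreal (1 / norm h powr ?e)"]
      by (simp only: mult.assoc mult.commute mult.left_commute zero_le)
  qed
  also have "\<dots> = (ennreal (4 * M\<^sup>2) * (2 * emeasure lborel (cball (0::'a) R))) *
      (\<integral>\<^sup>+(h::'a). ennreal (min 1 ((norm h)\<^sup>2) / norm h powr ?e) \<partial>lborel)"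
    by (rule nn_integral_cmult) measurable
  also have "\<dots> < \<infinity>"
    using nn_integral_fractional_kernel_finite[where 'a='a, OF s] M(3)
    by (simp add: ennreal_mult_less_top emeasure_cball)
  finally show ?thesis .
qed

section \<open>Passage to the closure and the eigenvalue\<close>

lemma ennreal_square_sum_le:
  fixes a b :: real
  shows "ennreal (\<bar>a + b\<bar>\<^sup>2) \<le> 2 * ennreal (\<bar>a\<bar>\<^sup>2) + 2 * ennreal (\<bar>b\<bar>\<^sup>2)"
proof -
  have "(a + b)\<^sup>2 \<le> 2 * a\<^sup>2 + 2 * b\<^sup>2"
    using sum_squares_bound[of a b] by (simp add: power2_eq_square algebra_simps)
  then show ?thesis
    by (simp add: ennreal_plus[symmetric] ennreal_mult[symmetric] ennreal_leI flip: ennreal_numeral del: ennreal_plus)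
qed

lemma L2_sq_add_le:
  assumes [measurable]: "f \<in> borel_measurable lebesgue" "g \<in> borel_measurable lebesgue" "A \<in> sets lebesgue"
  shows "L2_sq A (\<lambda>x. f x + g x) \<le> 2 * L2_sq A f + 2 * L2_sq A g"
proof -
  have "L2_sq A (\<lambda>x. f x + g x) \<le> (\<integral>\<^sup>+x. 2 * (ennreal (\<bar>f x\<bar>\<^sup>2) * indicator A x)
      + 2 * (ennreal (\<bar>g x\<bar>\<^sup>2) * indicator A x) \<partial>lebesgue)"
    unfolding L2_sq_def using ennreal_square_sum_le by (intro nn_integral_mono) (auto simp: indicator_def)
  also have "\<dots> = 2 * L2_sq A f + 2 * L2_sq A g"
    unfolding L2_sq_def by (subst nn_integral_add) (simp_all add: nn_integral_cmult)
  finally show ?thesis .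
qed

lemma gagliardo_sq_add_le:
  fixes f g :: "'a::euclidean_space \<Rightarrow> real"
  assumes f: "f \<in> borel_measurable lebesgue" and g: "g \<in> borel_measurable lebesgue"
  shows "gagliardo_sq s (\<lambda>x. f x + g x) \<le> 2 * gagliardo_sq s f + 2 * gagliardo_sq s g"
proof -
  let ?F = "\<lambda>f::'a \<Rightarrow> real. \<lambda>(x, y). ennreal (\<bar>f x - f y\<bar>\<^sup>2 / norm (x - y) powr (real DIM('a) + 2 * s))"
  have "gagliardo_sq s (\<lambda>x. f x + g x) \<le> (\<integral>\<^sup>+z. 2 * ?F f z + 2 * ?F g z \<partial>(lebesgue \<Otimes>\<^sub>M lebesgue))"
    unfolding gagliardo_sq_def
  proof (intro nn_integral_mono)
    fix z :: "'a \<times> 'a"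
    obtain x y where z: "z = (x, y)" by (cases z)
    let ?k = "norm (x - y) powr (real DIM('a) + 2 * s)"
    have div: "ennreal (a\<^sup>2 / ?k) = ennreal (a\<^sup>2) * ennreal (1 / ?k)" for a
      by (simp add: ennreal_mult[symmetric])
    have "ennreal (\<bar>f x + g x - (f y + g y)\<bar>\<^sup>2) \<le> 2 * ennreal (\<bar>f x - f y\<bar>\<^sup>2) + 2 * ennreal (\<bar>g x - g y\<bar>\<^sup>2)"
      using ennreal_square_sum_le[of "f x - f y" "g x - g y"] by (simp add: algebra_simps)
    from mult_right_mono[OF this, of "ennreal (1 / ?k)"]
    show "?F (\<lambda>x. f x + g x) z \<le> 2 * ?F f z + 2 * ?F g z"
      by (simp only: z prod.case div distrib_right mult.assoc zero_le)
  qed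
  also have "\<dots> = 2 * gagliardo_sq s f + 2 * gagliardo_sq s g"
  proof -
    have "(\<integral>\<^sup>+z. 2 * F z + 2 * G z \<partial>M) = 2 * (\<integral>\<^sup>+z. F z \<partial>M) + 2 * (\<integral>\<^sup>+z. G z \<partial>M)"
      if "F \<in> borel_measurable M" "G \<in> borel_measurable M" for F G :: "'a \<times> 'a \<Rightarrow> ennreal" and M
      using that by (subst nn_integral_add) (simp_all add: nn_integral_cmult)
    from this[OF measurable_gagliardo_integrand[OF f] measurable_gagliardo_integrand[OF g]]
    show ?thesis unfolding gagliardo_sq_def .
  qed
  finally show ?thesis .
qed

lemma L2_sq_minus: "L2_sq A (\<lambda>x. - f x) = L2_sq A f"
  by (simp add: L2_sq_def)

lemma gagliardo_sq_minus: "gagliardo_sq s (\<lambda>x. - f x) = gagliardo_sq s f"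
  by (simp add: gagliardo_sq_def abs_minus_commute)

lemma le_square_if_sqrt_enn2real_le:
  assumes "x < \<infinity>" "sqrt (enn2real x) \<le> \<epsilon>"
  shows "x \<le> ennreal (\<epsilon>\<^sup>2)"
proof -
  have "0 \<le> sqrt (enn2real x)" by simp
  then have "(sqrt (enn2real x))\<^sup>2 \<le> \<epsilon>\<^sup>2"
    using assms(2) by (intro power_mono)
  then have "enn2real x \<le> \<epsilon>\<^sup>2" by simp
  then show ?thesis
    using assms(1) by (metis enn2real_nonneg ennreal_enn2real ennreal_leI infinity_ennreal_def)
qed

text \<open>
  The norm in the definition of \<open>sobolev0\<close> is real-valued and sends infinite integrals to 0, so
  smallness of the norm yields smallness of the integrals only because these are finite, which
  needs finite energy of the test functions.
\<close>

lemma sobolev0_approximation: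
  fixes u :: "'a::euclidean_space \<Rightarrow> real"
  assumes u: "u \<in> sobolev0 s \<Omega>" and s: "0 < s" "s < 1" and \<epsilon>: "0 < \<epsilon>"
  shows "\<exists>\<phi>\<in>test_functions \<Omega>. (\<lambda>x. u x - \<phi> x) \<in> borel_measurable lebesgue \<and>
    L2_sq UNIV (\<lambda>x. u x - \<phi> x) \<le> ennreal (\<epsilon>\<^sup>2) \<and> gagliardo_sq s (\<lambda>x. u x - \<phi> x) \<le> ennreal (\<epsilon>\<^sup>2)"
proof -
  have u': "u \<in> borel_measurable lebesgue" "L2_sq UNIV u < \<infinity>" "gagliardo_sq s u < \<infinity>"
    using u by (auto simp: sobolev0_def sobolev_def)
  obtain \<phi> where \<phi>: "\<phi> \<in> test_functions \<Omega>" "sobolev_norm s (\<lambda>x. u x - \<phi> x) < \<epsilon>"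
    using u \<epsilon> by (auto simp: sobolev0_def)
  have m: "(\<lambda>x. - \<phi> x) \<in> borel_measurable lebesgue"
    using test_function_continuous[OF \<phi>(1)]
    by (intro measurable_completion) (auto intro!: borel_measurable_continuous_onI continuous_intros)
  have "L2_sq UNIV (\<lambda>x. u x + - \<phi> x) < \<infinity>"
    using L2_sq_add_le[OF u'(1) m, of UNIV] u' test_function_L2_finite[OF \<phi>(1)]
    by (auto simp: L2_sq_minus ennreal_mult_less_top intro: le_less_trans)
  moreover have "gagliardo_sq s (\<lambda>x. u x + - \<phi> x) < \<infinity>"
    using gagliardo_sq_add_le[OF u'(1) m, of s] u' test_function_gagliardo_finite[OF \<phi>(1) s]
    by (auto simp: gagliardo_sq_minus ennreal_mult_less_top intro: le_less_trans)
  moreover have "L2_norm UNIV (\<lambda>x. u x - \<phi> x) \<le> \<epsilon>" "gagliardo_seminorm s (\<lambda>x. u x - \<phi> x) \<le> \<epsilon>"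
  proof -
    have "0 \<le> L2_norm UNIV (\<lambda>x. u x - \<phi> x)" "0 \<le> gagliardo_seminorm s (\<lambda>x. u x - \<phi> x)"
      by (simp_all add: L2_norm_def gagliardo_seminorm_def)
    then show "L2_norm UNIV (\<lambda>x. u x - \<phi> x) \<le> \<epsilon>" "gagliardo_seminorm s (\<lambda>x. u x - \<phi> x) \<le> \<epsilon>"
      using \<phi>(2) unfolding sobolev_norm_def by linarith+
  qed
  ultimately have "L2_sq UNIV (\<lambda>x. u x - \<phi> x) \<le> ennreal (\<epsilon>\<^sup>2)" "gagliardo_sq s (\<lambda>x. u x - \<phi> x) \<le> ennreal (\<epsilon>\<^sup>2)"
    by (auto simp: L2_norm_def gagliardo_seminorm_def intro!: le_square_if_sqrt_enn2real_le)
  moreover have "(\<lambda>x. u x + - \<phi> x) \<in> borel_measurable lebesgue"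
    using u'(1) m by (rule borel_measurable_add)
  ultimately show ?thesis using \<phi>(1) by auto
qed

lemma ennreal_eq_0_if_le_all:
  assumes "\<And>\<epsilon>. 0 < \<epsilon> \<Longrightarrow> x \<le> ennreal (\<epsilon>\<^sup>2)"
  shows "x = 0"
proof -
  have "x \<le> ennreal 1" using assms[of 1] by simp
  then obtain y where y: "x = ennreal y" "0 \<le> y"
    by (cases x) (auto simp: top_unique)
  have "y \<le> 0"
  proof (rule field_le_epsilon)
    fix e :: real assume "0 < e"
    then show "y \<le> 0 + e"
      using assms[of "sqrt e"] y by simp
  qed
  then show ?thesis using y by simp
qed

text \<open>
  Test functions vanish outside \<open>\<Omega>\<close>, hence so do their \<open>L\<^sup>2\<close> limits. Thus the denominator of the
  Rayleigh quotient is positive for every admissible function.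
\<close>

lemma sobolev0_vanishes_outside:
  fixes u :: "'a::euclidean_space \<Rightarrow> real"
  assumes u: "u \<in> sobolev0 s \<Omega>" and s: "0 < s" "s < 1" and \<Omega>: "open \<Omega>"
  shows "L2_sq \<Omega> u = L2_sq UNIV u"
proof -
  have [measurable]: "u \<in> borel_measurable lebesgue"
    using u by (auto simp: sobolev0_def sobolev_def)
  have [measurable]: "\<Omega> \<in> sets lebesgue" "- \<Omega> \<in> sets lebesgue"
    using \<Omega> by (auto simp: borel_open)
  have "L2_sq (- \<Omega>) u = 0"
  proof (rule ennreal_eq_0_if_le_all)
    fix \<epsilon> :: real assume "0 < \<epsilon>"
    then obtain \<phi> where \<phi>: "\<phi> \<in> test_functions \<Omega>" "L2_sq UNIV (\<lambda>x. u x - \<phi> x) \<le> ennreal (\<epsilon>\<^sup>2)"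
      using sobolev0_approximation[OF u s] by blast
    have "L2_sq (- \<Omega>) u \<le> L2_sq UNIV (\<lambda>x. u x - \<phi> x)"
      unfolding L2_sq_def using test_function_vanishes[OF \<phi>(1)]
      by (intro nn_integral_mono) (auto simp: indicator_def)
    then show "L2_sq (- \<Omega>) u \<le> ennreal (\<epsilon>\<^sup>2)" using \<phi>(2) by simp
  qed
  moreover have "L2_sq UNIV u = L2_sq \<Omega> u + L2_sq (- \<Omega>) u"
    unfolding L2_sq_def by (subst nn_integral_add[symmetric]) (auto intro!: nn_integral_cong simp: indicator_def)
  ultimately show ?thesis by simp
qed

text \<open>
  With \<open>(a + b)\<^sup>2 \<le> 2 a\<^sup>2 + 2 b\<^sup>2\<close> in place of the triangle inequality, the passage to the limit
  costs a factor 2 in the norm and a factor 2 in the energy, which is harmless for a universal constant.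
\<close>

lemma fractional_makai_hayman_sobolev0:
  fixes u :: "real ^ 2 \<Rightarrow> real"
  assumes s: "1/2 < s" "s < 1"
    and \<Omega>: "open \<Omega>" "simply_connected \<Omega>" "inradius \<Omega> = ereal r" and r: "0 < r"
    and u: "u \<in> sobolev0 s \<Omega>"
  shows "enn2real (L2_sq UNIV u) \<le> 16000000 * (1 - s) / (s - 1/2) * (8 * r) powr (2 * s) * enn2real (gagliardo_sq s u)"
proof -
  define \<kappa> where "\<kappa> = 4000000 * (1 - s) / (s - 1/2) * (8 * r) powr (2 * s)"
  have \<kappa>: "0 \<le> \<kappa>" using s by (simp add: \<kappa>_def)
  have s0: "0 < s" using s by simp
  have u': "u \<in> borel_measurable lebesgue" "L2_sq UNIV u < \<infinity>" "gagliardo_sq s u < \<infinity>"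
    using u by (auto simp: sobolev0_def sobolev_def)
  define a g where "a = enn2real (L2_sq UNIV u)" and "g = enn2real (gagliardo_sq s u)"
  have ag: "L2_sq UNIV u = ennreal a" "gagliardo_sq s u = ennreal g" "0 \<le> a" "0 \<le> g"
    using u' by (simp_all add: a_def g_def less_top[symmetric])
  have step: "a \<le> 4 * \<kappa> * g + (4 * \<kappa> + 2) * \<epsilon>\<^sup>2" if \<epsilon>: "0 < \<epsilon>" for \<epsilon>
  proof -
    obtain \<phi> where \<phi>: "\<phi> \<in> test_functions \<Omega>" and d: "(\<lambda>x. u x - \<phi> x) \<in> borel_measurable lebesgue"
      "L2_sq UNIV (\<lambda>x. u x - \<phi> x) \<le> ennreal (\<epsilon>\<^sup>2)" "gagliardo_sq s (\<lambda>x. u x - \<phi> x) \<le> ennreal (\<epsilon>\<^sup>2)"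
      using sobolev0_approximation[OF u s0 s(2) \<epsilon>] by blast
    have m\<phi>: "\<phi> \<in> borel_measurable lebesgue"
      using test_function_continuous[OF \<phi>] by (intro measurable_completion) (auto intro!: borel_measurable_continuous_onI)
    have md: "(\<lambda>x. - (u x - \<phi> x)) \<in> borel_measurable lebesgue"
      using d(1) by (rule borel_measurable_uminus)
    have "gagliardo_sq s \<phi> \<le> 2 * gagliardo_sq s u + 2 * gagliardo_sq s (\<lambda>x. u x - \<phi> x)"
      using gagliardo_sq_add_le[OF u'(1) md, of s] by (simp only: gagliardo_sq_minus) simp
    also have "\<dots> \<le> 2 * ennreal g + 2 * ennreal (\<epsilon>\<^sup>2)"
      unfolding ag using d by (intro add_mono mult_left_mono) auto
    finally have G\<phi>: "gagliardo_sq s \<phi> \<le> 2 * ennreal g + 2 * ennreal (\<epsilon>\<^sup>2)" .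
    have "ennreal a \<le> 2 * L2_sq UNIV \<phi> + 2 * L2_sq UNIV (\<lambda>x. u x - \<phi> x)"
      using L2_sq_add_le[OF m\<phi> d(1), of UNIV] by (simp add: ag)
    also have "\<dots> \<le> 2 * (ennreal \<kappa> * (2 * ennreal g + 2 * ennreal (\<epsilon>\<^sup>2))) + 2 * ennreal (\<epsilon>\<^sup>2)"
    proof (intro add_mono mult_left_mono d)
      have "L2_sq UNIV \<phi> \<le> ennreal \<kappa> * gagliardo_sq s \<phi>"
        unfolding \<kappa>_def using test_function_vanishes[OF \<phi>]
        by (intro fractional_makai_hayman_continuous[OF s \<Omega> r test_function_continuous[OF \<phi>]])
      also have "\<dots> \<le> ennreal \<kappa> * (2 * ennreal g + 2 * ennreal (\<epsilon>\<^sup>2))"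
        by (intro mult_left_mono G\<phi>) simp
      finally show "L2_sq UNIV \<phi> \<le> ennreal \<kappa> * (2 * ennreal g + 2 * ennreal (\<epsilon>\<^sup>2))" .
    qed simp_all
    also have "\<dots> = ennreal (4 * \<kappa> * g + (4 * \<kappa> + 2) * \<epsilon>\<^sup>2)"
    proof -
      have "2 * ennreal x = ennreal (2 * x)" if "0 \<le> x" for x using that by (simp add: ennreal_mult)
      then have "2 * (ennreal \<kappa> * (2 * ennreal g + 2 * ennreal (\<epsilon>\<^sup>2))) + 2 * ennreal (\<epsilon>\<^sup>2)
          = ennreal (2 * (\<kappa> * (2 * g + 2 * \<epsilon>\<^sup>2)) + 2 * \<epsilon>\<^sup>2)"
        using \<kappa> ag by (simp add: ennreal_plus[symmetric] ennreal_mult[symmetric] del: ennreal_plus)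
      then show ?thesis by (simp add: algebra_simps)
    qed
    finally show ?thesis
      using \<kappa> ag by (subst (asm) ennreal_le_iff) auto
  qed
  have "a \<le> 4 * \<kappa> * g"
  proof (rule field_le_epsilon)
    fix e :: real assume "0 < e"
    then have "(4 * \<kappa> + 2) * (sqrt (e / (4 * \<kappa> + 2)))\<^sup>2 = e" "0 < sqrt (e / (4 * \<kappa> + 2))"
      using \<kappa> by (simp_all add: add_nonneg_pos)
    then show "a \<le> 4 * \<kappa> * g + e"
      using step[of "sqrt (e / (4 * \<kappa> + 2))"] by simp
  qed
  also have "4 * \<kappa> * g = 16000000 * (1 - s) / (s - 1/2) * (8 * r) powr (2 * s) * g"
  proof -
    have "4 * (4000000 * X / Y * P) * g = 16000000 * X / Y * P * g" for X Y P :: real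
      by simp
    then show ?thesis unfolding \<kappa>_def .
  qed
  finally show ?thesis by (simp only: a_def g_def)
qed

text \<open>
  The factor 64 bounds \<open>8 powr (2 * s)\<close>, and \<open>64 * 16000000 = 1024000000\<close>.
\<close>

lemma fractional_makai_hayman:
  fixes \<Omega> :: "(real ^ 2) set"
  assumes s: "1/2 < s" "s < 1"
    and \<Omega>: "open \<Omega>" "\<Omega> \<noteq> {}" "simply_connected \<Omega>" "inradius \<Omega> = ereal r"
  shows "ereal ((s - 1/2) / (1 - s) / 1024000000 / r powr (2 * s)) \<le> first_eigenvalue s \<Omega>"
  unfolding first_eigenvalue_def
proof (rule INF_greatest)
  fix u assume "u \<in> {u \<in> sobolev0 s \<Omega>. \<not> (AE x in lebesgue. u x = 0)}"
  then have u: "u \<in> sobolev0 s \<Omega>" "\<not> (AE x in lebesgue. u x = 0)" by auto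
  have r: "0 < r" using inradius_pos[OF \<Omega>(1,2,4)] .
  have s0: "0 < s" using s by simp
  define a g where "a = enn2real (L2_sq UNIV u)" and "g = enn2real (gagliardo_sq s u)"
  have [measurable]: "u \<in> borel_measurable lebesgue" and fin: "L2_sq UNIV u < \<infinity>"
    using u(1) by (auto simp: sobolev0_def sobolev_def)
  have "L2_sq UNIV u \<noteq> 0"
    using u(2) unfolding L2_sq_def by (subst nn_integral_0_iff_AE) auto
  then have a: "0 < a"
    using fin by (simp add: a_def enn2real_positive_iff zero_less_iff_neq_zero)
  have g: "0 \<le> g" by (simp add: g_def)
  have "a \<le> 16000000 * (1 - s) / (s - 1/2) * (8 * r) powr (2 * s) * g"
    unfolding a_def g_def by (rule fractional_makai_hayman_sobolev0[OF s \<Omega>(1,3,4) r u(1)])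
  also have "\<dots> \<le> 16000000 * (1 - s) / (s - 1/2) * (64 * r powr (2 * s)) * g"
  proof -
    have "(8 * r) powr (2 * s) = 8 powr (2 * s) * r powr (2 * s)"
      using r by (simp add: powr_mult)
    also have "\<dots> \<le> 8 powr 2 * r powr (2 * s)"
      using s by (intro mult_right_mono powr_mono) auto
    finally have "(8 * r) powr (2 * s) \<le> 64 * r powr (2 * s)" by simp
    then show ?thesis
      using s g by (intro mult_right_mono mult_left_mono) auto
  qed
  finally have bound: "a \<le> 16000000 * (1 - s) / (s - 1/2) * (64 * r powr (2 * s)) * g" .
  have "(s - 1/2) / (1 - s) / 1024000000 / r powr (2 * s) \<le> g / a"
  proof -
    define K where "K = 1024000000 * ((1 - s) / (s - 1/2)) * r powr (2 * s)"
    have K: "0 < K" using s r by (simp add: K_def)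
    have "a \<le> K * g" using bound by (simp add: K_def mult_ac)
    then have "1 / K \<le> g / a" using K a by (simp add: field_simps)
    moreover have "1 / K = (s - 1/2) / (1 - s) / 1024000000 / r powr (2 * s)"
      by (simp add: K_def)
    ultimately show ?thesis by simp
  qed
  moreover have "(gagliardo_seminorm s u)\<^sup>2 / (L2_norm \<Omega> u)\<^sup>2 = g / a"
    by (simp add: gagliardo_seminorm_def L2_norm_def sobolev0_vanishes_outside[OF u(1) s0 s(2) \<Omega>(1)] a_def g_def)
  ultimately show "ereal ((s - 1/2) / (1 - s) / 1024000000 / r powr (2 * s))
      \<le> ereal ((gagliardo_seminorm s u)\<^sup>2 / (L2_norm \<Omega> u)\<^sup>2)"
    by simp
qed

theorem theorem1p1:
  shows "\<exists>C :: real \<Rightarrow> real.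
    (\<forall>s. 1/2 < s \<and> s < 1 \<longrightarrow>
       C s > 0 \<and>
       (\<forall>(\<Omega> :: (real^2) set) (r :: real).
          open \<Omega> \<and> \<Omega> \<noteq> {} \<and> simply_connected \<Omega> \<and> inradius \<Omega> = ereal r \<longrightarrow>
          first_eigenvalue s \<Omega> \<ge> ereal (C s / r powr (2 * s)))) \<and>
    comparable_at (at_right (1/2)) C (\<lambda>s. s - 1/2) \<and>
    comparable_at (at_left 1) C (\<lambda>s. 1 / (1 - s))"
proof (intro exI conjI allI impI; (elim conjE)?)
  let ?C = "\<lambda>s::real. (s - 1/2) / (1 - s) / 1024000000"
  show "0 < ?C s" if "1/2 < s" "s < 1" for s :: real
    using that by simp
  show "ereal (?C s / r powr (2 * s)) \<le> first_eigenvalue s \<Omega>"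
    if "1/2 < s" "s < 1" "open \<Omega>" "\<Omega> \<noteq> {}" "simply_connected \<Omega>" "inradius \<Omega> = ereal r"
    for s r and \<Omega> :: "(real ^ 2) set"
    using fractional_makai_hayman[OF that] by simp
  show "comparable_at (at_right (1/2)) ?C (\<lambda>s. s - 1/2)"
    unfolding comparable_at_def
  proof (intro exI conjI)
    have "((\<lambda>s::real. 1 / (1 - s) / 1024000000) \<longlongrightarrow> 1 / (1 - 1/2) / 1024000000) (at_right (1/2))"
      by (intro tendsto_intros) auto
    moreover have "\<forall>\<^sub>F s in at_right (1/2). 1 / (1 - s) / 1024000000 = ?C s / (s - 1/2)"
      using eventually_at_right_less[of "1/2 :: real"] by eventually_elim simp
    ultimately show "((\<lambda>s. ?C s / (s - 1/2)) \<longlongrightarrow> 1 / (1 - 1/2) / 1024000000) (at_right (1/2))"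
      by (rule Lim_transform_eventually)
  qed simp
  show "comparable_at (at_left 1) ?C (\<lambda>s. 1 / (1 - s))"
    unfolding comparable_at_def
  proof (intro exI conjI)
    have "((\<lambda>s::real. (s - 1/2) / 1024000000) \<longlongrightarrow> (1 - 1/2) / 1024000000) (at_left 1)"
      by (intro tendsto_intros) auto
    moreover have "\<forall>\<^sub>F s in at_left 1. (s - 1/2) / 1024000000 = ?C s / (1 / (1 - s))"
      using eventually_at_left_real[OF zero_less_one]
    proof eventually_elim
      case (elim s)
      have cancel: "x / K = x / y / K / (1 / y)" if "y \<noteq> 0" for x y K :: real
        using that by simp
      show ?case by (rule cancel) (use elim in simp)
    qed
    ultimately show "((\<lambda>s. ?C s / (1 / (1 - s))) \<longlongrightarrow> (1 - 1/2) / 1024000000) (at_left 1)"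
      by (rule Lim_transform_eventually)
  qed simp
qed

end
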